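(* Let $m\ge1$ and let $A:\mathcal{M}\to\mathcal{N}$ be a nonzero pure contraction (that is, $\|Ah\|_{\mathcal{N}}<\|h\|_{\mathcal{M}}$ for all $h\in\mathcal{M}$, $h\ne0$) between separable complex Hilbert spaces. Let $\mathcal{H}=\bigoplus_{n\in\mathbb{Z}}\mathcal{L}_n$, where $\mathcal{L}_n=\mathcal{N}$ for $n\ge0$ and $\mathcal{L}_n=\mathcal{M}$ for $n\le-1$, and let $T_A\in\mathcal{L}(\mathcal{H})$ be defined by $$T_A|_{\mathcal{L}_n}=\begin{cases}D_{A^*}:\mathcal{L}_{m-1}\to\mathcal{L}_m,&n=m-1,\\ -A:\mathcal{L}_{-1}\to\mathcal{L}_m,&n=-1,\\ I:\mathcal{L}_n\to\mathcal{L}_{n+1},&n\ne-1,m-1.\end{cases}$$ Then $T_A$ is a completely non unitary partial isometry and the characteristic function of $T_A$ coincides with $\Theta(z)=Az^m$. Moreover, the upper triangular representation of $T_A$ with respect to the decomposition $$\mathcal{H}=\Big(\bigoplus_{n\ge m}\mathcal{L}_n\Big)\oplus\Big(\bigoplus_{n=0}^{m-1}\mathcal{L}_n\Big)\oplus\Big(\bigoplus_{n\le-1}\mathcal{L}_n\Big)$$ coincides with the canonical representation of $T_A$.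
   Context: $D_{A^*}=(I-AA^* )^{1/2}$. A contraction $T$ is completely non unitary (c.n.u.) if there is no nonzero $T$-reducing subspace on which $T$ is unitary. Put $D_T=(I-T^*T)^{1/2}$, $D_{T^*}=(I-TT^* )^{1/2}$, $\mathcal{D}_T=\overline{\mathrm{Ran}\,D_T}$, $\mathcal{D}_{T^*}=\overline{\mathrm{Ran}\,D_{T^*}}$. The characteristic function of $T$ is $\Theta_T(z)=[-T+zD_{T^*}(I-zT^* )^{-1}D_T]|_{\mathcal{D}_T}\in\mathcal{L}(\mathcal{D}_T,\mathcal{D}_{T^*})$, $z\in\mathbb{D}$. Operator valued functions $\Theta:\mathbb{D}\to\mathcal{L}(\mathcal{E},\mathcal{E}_* )$ and $\Psi:\mathbb{D}\to\mathcal{L}(\mathcal{F},\mathcal{F}_* )$ coincide if there are unitaries $\tau:\mathcal{E}\to\mathcal{F}$, $\tau_*:\mathcal{E}_*\to\mathcal{F}_*$ with $\tau_*\Theta(z)=\Psi(z)\tau$ for all $z\in\mathbb{D}$. For a c.n.u. contraction $T$ on $\mathcal{H}$ whose characteristic function is a polynomial of degree $d$, the canonical representation is the block upper triangular representation of $T$ with respect to $\mathcal{H}=\mathcal{H}^{(c)}_1\oplus\mathcal{H}^{(c)}_0\oplus\mathcal{H}^{(c)}_{-1}$, where $\mathcal{H}^{(c)}_1=\overline{\mathrm{span}}\{T^kh:h\in\mathcal{D}_{T^*},k\ge d\}$, $\mathcal{H}^{(c)}_{-1}=\{h:\|T^{*(k+1)}h\|=\|T^{*k}h\|,k\ge0\}$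 and $\mathcal{H}^{(c)}_0=\mathcal{H}\ominus(\mathcal{H}^{(c)}_1\oplus\mathcal{H}^{(c)}_{-1})$. (Equivalently: among all orthogonal three-term decompositions in which $T$ is block upper triangular with diagonal entries a unilateral shift, a nilpotent of order $d$, and the adjoint of a unilateral shift, it is the unique one with the smallest first space and the largest third space.) *)

theory Defs
  imports "HOL-Analysis.Analysis"
begin

section \<open>Complex Hilbert spaces\<close>

class complex_vector = real_vector +
  fixes scaleC :: "complex \<Rightarrow> 'a \<Rightarrow> 'a"  (infixr \<open>*\<^sub>C\<close> 75)
  assumes scaleC_add_right: "a *\<^sub>C (x + y) = a *\<^sub>C x + a *\<^sub>C y"
    and scaleC_add_left: "(a + b) *\<^sub>C x = a *\<^sub>C x + b *\<^sub>C x"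
    and scaleC_scaleC: "a *\<^sub>C (b *\<^sub>C x) = (a * b) *\<^sub>C x"
    and scaleC_one: "1 *\<^sub>C x = x"
    and scaleR_scaleC: "r *\<^sub>R x = complex_of_real r *\<^sub>C x"

global_interpretation complex_vector: vector_space "scaleC :: complex \<Rightarrow> 'a \<Rightarrow> 'a::complex_vector"
  defines csubspace = complex_vector.subspace
    and cspan = complex_vector.span
  by unfold_locales (simp_all add: scaleC_add_right scaleC_add_left scaleC_scaleC scaleC_one)

text \<open>
  The complex inner product is linear in its first argument.  Its real part is the inner product
  of \<^class>\<open>real_inner\<close>, so positive definiteness and \<open>\<parallel>x\<parallel>\<^sup>2 = \<langle>x, x\<rangle>\<close> are inherited from there.
\<close>

class complex_inner = complex_vector + real_inner +
  fixes cinner :: "'a \<Rightarrow> 'a \<Rightarrow> complex"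
  assumes cinner_commute: "cinner x y = cnj (cinner y x)"
    and cinner_add_left: "cinner (x + y) z = cinner x z + cinner y z"
    and cinner_scaleC_left: "cinner (a *\<^sub>C x) y = a * cinner x y"
    and Re_cinner: "Re (cinner x y) = inner x y"

class complex_hilbert = complex_inner + complete_space

lemma cinner_self: "cinner x x = complex_of_real ((norm x)\<^sup>2)" for x :: "'a::complex_inner"
proof (rule complex_eqI)
  show "Re (cinner x x) = Re (complex_of_real ((norm x)\<^sup>2))"
    by (simp add: Re_cinner power2_norm_eq_inner)
  show "Im (cinner x x) = Im (complex_of_real ((norm x)\<^sup>2))"
    using arg_cong[OF cinner_commute[of x x], of Im] by simp
qed

lemma cinner_scaleC_right: "cinner x (a *\<^sub>C y) = cnj a * cinner x y" for x y :: "'a::complex_inner"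
  by (metis cinner_commute cinner_scaleC_left complex_cnj_mult)

lemma norm_scaleC: "norm (a *\<^sub>C x) = cmod a * norm x" for x :: "'a::complex_inner"
proof -
  have "complex_of_real ((norm (a *\<^sub>C x))\<^sup>2) = (a * cnj a) * cinner x x"
    unfolding cinner_self[symmetric] cinner_scaleC_left cinner_scaleC_right by (simp add: ac_simps)
  also have "\<dots> = complex_of_real ((cmod a * norm x)\<^sup>2)"
    unfolding cinner_self complex_norm_square[symmetric] power_mult_distrib
    by (rule of_real_mult[symmetric])
  finally have "(norm (a *\<^sub>C x))\<^sup>2 = (cmod a * norm x)\<^sup>2"
    unfolding of_real_eq_iff .
  then show ?thesis
    by (rule power2_eq_imp_eq) simp_all
qed

lemma cmod_cinner_le: "cmod (cinner x y) \<le> norm x * norm y" for x y :: "'a::complex_inner"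
proof (cases "cinner x y = 0")
  case False
  define a where "a = cnj (cinner x y) / cmod (cinner x y)"
  have a: "cmod a = 1"
    using False by (simp add: a_def norm_divide)
  have "a * cinner x y = (cinner x y * cnj (cinner x y)) / cmod (cinner x y)"
    by (simp add: a_def mult.commute)
  also have "\<dots> = complex_of_real ((cmod (cinner x y))\<^sup>2 / cmod (cinner x y))"
    unfolding complex_norm_square[symmetric] of_real_divide ..
  also have "\<dots> = complex_of_real (cmod (cinner x y))"
    by (simp add: power2_eq_square)
  finally have "cmod (cinner x y) = inner (a *\<^sub>C x) y"
    by (metis Re_cinner Re_complex_of_real cinner_scaleC_left)
  also have "\<dots> \<le> norm (a *\<^sub>C x) * norm y"
    by (rule norm_cauchy_schwarz)
  also have "\<dots> = norm x * norm y"
    by (simp add: norm_scaleC a)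
  finally show ?thesis .
qed simp

instantiation prod :: (complex_vector, complex_vector) complex_vector
begin

definition scaleC_prod_def: "a *\<^sub>C p = (a *\<^sub>C fst p, a *\<^sub>C snd p)"

instance
  by standard (auto simp: scaleC_prod_def scaleC_add_right scaleC_add_left scaleC_scaleC scaleC_one
      scaleR_scaleC prod_eq_iff)

end

instantiation prod :: (complex_inner, complex_inner) complex_inner
begin

definition cinner_prod_def: "cinner p q = cinner (fst p) (fst q) + cinner (snd p) (snd q)"

instance
proof
  fix p q r :: "'a \<times> 'b" and a :: complex
  show "cinner p q = cnj (cinner q p)"
    unfolding cinner_prod_def complex_cnj_add
    by (intro arg_cong2[where f = "(+)"] cinner_commute)
  show "cinner (p + q) r = cinner p r + cinner q r"
    by (simp add: cinner_prod_def cinner_add_left)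
  show "cinner (a *\<^sub>C p) q = a * cinner p q"
    by (simp add: cinner_prod_def scaleC_prod_def cinner_scaleC_left algebra_simps)
  show "Re (cinner p q) = inner p q"
    by (simp add: cinner_prod_def Re_cinner inner_prod_def)
qed

end

instance prod :: (complex_hilbert, complex_hilbert) complex_hilbert ..


section \<open>Operators\<close>

definition bounded_clinear :: "('a::complex_inner \<Rightarrow> 'b::complex_inner) \<Rightarrow> bool" where
  "bounded_clinear f \<longleftrightarrow> bounded_linear f \<and> (\<forall>a x. f (a *\<^sub>C x) = a *\<^sub>C f x)"

text \<open>\<open>f|E \<in> L(E, F)\<close> for subspaces \<open>E\<close>, \<open>F\<close>; the values of \<open>f\<close> outside \<open>E\<close> are irrelevant.\<close>

definition bounded_clinear_on ::
    "'a::complex_inner set \<Rightarrow> 'b::complex_inner set \<Rightarrow> ('a \<Rightarrow> 'b) \<Rightarrow> bool" where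
  "bounded_clinear_on E F f \<longleftrightarrow>
     f ` E \<subseteq> F \<and>
     (\<forall>x\<in>E. \<forall>y\<in>E. f (x + y) = f x + f y) \<and>
     (\<forall>a. \<forall>x\<in>E. f (a *\<^sub>C x) = a *\<^sub>C f x) \<and>
     (\<exists>K. \<forall>x\<in>E. norm (f x) \<le> K * norm x)"

definition unitary_on ::
    "'a::complex_inner set \<Rightarrow> 'b::complex_inner set \<Rightarrow> ('a \<Rightarrow> 'b) \<Rightarrow> bool" where
  "unitary_on E F U \<longleftrightarrow>
     bounded_clinear_on E F U \<and> U ` E = F \<and> (\<forall>x\<in>E. norm (U x) = norm x)"

definition cadjoint :: "('a::complex_hilbert \<Rightarrow> 'b::complex_hilbert) \<Rightarrow> 'b \<Rightarrow> 'a" where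
  "cadjoint T = (THE S. \<forall>x y. cinner (T x) y = cinner x (S y))"

definition positive_op :: "('a::complex_hilbert \<Rightarrow> 'a) \<Rightarrow> bool" where
  "positive_op P \<longleftrightarrow>
     bounded_clinear P \<and> (\<forall>x. Im (cinner (P x) x) = 0 \<and> 0 \<le> Re (cinner (P x) x))"

definition op_sqrt :: "('a::complex_hilbert \<Rightarrow> 'a) \<Rightarrow> 'a \<Rightarrow> 'a" where
  "op_sqrt P = (THE R. positive_op R \<and> (\<forall>x. R (R x) = P x))"

text \<open>\<open>D\<^sub>T\<close>; the operator \<open>D\<^bsub>T*\<^esub>\<close> is \<open>defect_op (cadjoint T)\<close>, since \<open>T** = T\<close>.\<close>

definition defect_op :: "('a::complex_hilbert \<Rightarrow> 'b::complex_hilbert) \<Rightarrow> 'a \<Rightarrow> 'a" where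
  "defect_op T = op_sqrt (\<lambda>x. x - cadjoint T (T x))"

definition defect_space :: "('a::complex_hilbert \<Rightarrow> 'b::complex_hilbert) \<Rightarrow> 'a set" where
  "defect_space T = closure (range (defect_op T))"

definition contraction :: "('a::complex_inner \<Rightarrow> 'b::complex_inner) \<Rightarrow> bool" where
  "contraction T \<longleftrightarrow> bounded_clinear T \<and> (\<forall>x. norm (T x) \<le> norm x)"

definition pure_contraction :: "('a::complex_inner \<Rightarrow> 'b::complex_inner) \<Rightarrow> bool" where
  "pure_contraction T \<longleftrightarrow> bounded_clinear T \<and> (\<forall>x. x \<noteq> 0 \<longrightarrow> norm (T x) < norm x)"

definition closed_csubspace :: "'a::complex_inner set \<Rightarrow> bool" where
  "closed_csubspace S \<longleftrightarrow> csubspace S \<and> closed S"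

definition reducing_subspace :: "('a::complex_hilbert \<Rightarrow> 'a) \<Rightarrow> 'a set \<Rightarrow> bool" where
  "reducing_subspace T S \<longleftrightarrow> closed_csubspace S \<and> T ` S \<subseteq> S \<and> cadjoint T ` S \<subseteq> S"

definition completely_non_unitary :: "('a::complex_hilbert \<Rightarrow> 'a) \<Rightarrow> bool" where
  "completely_non_unitary T \<longleftrightarrow>
     contraction T \<and> \<not> (\<exists>S. reducing_subspace T S \<and> S \<noteq> {0} \<and> unitary_on S S T)"

definition orth_complement :: "'a::complex_inner set \<Rightarrow> 'a set" where
  "orth_complement S = {x. \<forall>y\<in>S. cinner x y = 0}"

definition partial_isometry :: "('a::complex_inner \<Rightarrow> 'b::complex_inner) \<Rightarrow> bool" where
  "partial_isometry T \<longleftrightarrow>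
     bounded_clinear T \<and> (\<forall>x \<in> orth_complement {y. T y = 0}. norm (T x) = norm x)"


section \<open>Characteristic functions\<close>

definition char_fun :: "('a::complex_hilbert \<Rightarrow> 'a) \<Rightarrow> complex \<Rightarrow> 'a \<Rightarrow> 'a" where
  "char_fun T z x =
     - T x + z *\<^sub>C defect_op (cadjoint T) (inv (\<lambda>y. y - z *\<^sub>C cadjoint T y) (defect_op T x))"

definition op_valued_function ::
    "'a::complex_inner set \<Rightarrow> 'b::complex_inner set \<Rightarrow> (complex \<Rightarrow> 'a \<Rightarrow> 'b) \<Rightarrow> bool" where
  "op_valued_function E F \<Theta> \<longleftrightarrow> (\<forall>z\<in>ball 0 1. bounded_clinear_on E F (\<Theta> z))"

definition coincide ::
    "'a::complex_hilbert set \<Rightarrow> 'b::complex_hilbert set \<Rightarrow> (complex \<Rightarrow> 'a \<Rightarrow> 'b) \<Rightarrow>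
     'c::complex_hilbert set \<Rightarrow> 'd::complex_hilbert set \<Rightarrow> (complex \<Rightarrow> 'c \<Rightarrow> 'd) \<Rightarrow> bool" where
  "coincide E E' \<Theta> F F' \<Psi> \<longleftrightarrow>
     op_valued_function E E' \<Theta> \<and> op_valued_function F F' \<Psi> \<and>
     (\<exists>\<tau> \<tau>'. unitary_on E F \<tau> \<and> unitary_on E' F' \<tau>' \<and>
        (\<forall>z\<in>ball 0 1. \<forall>x\<in>E. \<tau>' (\<Theta> z x) = \<Psi> z (\<tau> x)))"

definition op_polynomial ::
    "'a::complex_inner set \<Rightarrow> 'b::complex_inner set \<Rightarrow> (complex \<Rightarrow> 'a \<Rightarrow> 'b) \<Rightarrow> nat \<Rightarrow> bool" where
  "op_polynomial E F \<Theta> d \<longleftrightarrow>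
     (\<exists>C :: nat \<Rightarrow> 'a \<Rightarrow> 'b.
        (\<forall>k\<le>d. bounded_clinear_on E F (C k)) \<and> (\<exists>x\<in>E. C d x \<noteq> 0) \<and>
        (\<forall>z\<in>ball 0 1. \<forall>x\<in>E. \<Theta> z x = (\<Sum>k\<le>d. z ^ k *\<^sub>C C k x)))"


section \<open>The canonical representation\<close>

text \<open>
  \<open>T\<close> is block upper triangular with respect to the orthogonal decomposition of the whole space
  into \<open>S1\<close>, \<open>S0\<close>, \<open>S2\<close>, in this order.
\<close>

definition upper_triangular_rep ::
    "('a::complex_hilbert \<Rightarrow> 'a) \<Rightarrow> 'a set \<Rightarrow> 'a set \<Rightarrow> 'a set \<Rightarrow> bool" where
  "upper_triangular_rep T S1 S0 S2 \<longleftrightarrow>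
     closed_csubspace S1 \<and> closed_csubspace S0 \<and> closed_csubspace S2 \<and>
     S1 \<subseteq> orth_complement S0 \<and> S1 \<subseteq> orth_complement S2 \<and> S0 \<subseteq> orth_complement S2 \<and>
     (\<forall>h. \<exists>a\<in>S1. \<exists>b\<in>S0. \<exists>c\<in>S2. h = a + b + c) \<and>
     T ` S1 \<subseteq> S1 \<and> T ` S0 \<subseteq> {a + b |a b. a \<in> S1 \<and> b \<in> S0}"

definition canonical_space_1 :: "('a::complex_hilbert \<Rightarrow> 'a) \<Rightarrow> nat \<Rightarrow> 'a set" where
  "canonical_space_1 T d =
     closure (cspan {(T ^^ k) h |k h. d \<le> k \<and> h \<in> defect_space (cadjoint T)})"

definition canonical_space_minus1 :: "('a::complex_hilbert \<Rightarrow> 'a) \<Rightarrow> 'a set" where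
  "canonical_space_minus1 T =
     {h. \<forall>k. norm ((cadjoint T ^^ (k + 1)) h) = norm ((cadjoint T ^^ k) h)}"

definition canonical_space_0 :: "('a::complex_hilbert \<Rightarrow> 'a) \<Rightarrow> nat \<Rightarrow> 'a set" where
  "canonical_space_0 T d =
     orth_complement {a + b |a b. a \<in> canonical_space_1 T d \<and> b \<in> canonical_space_minus1 T}"

text \<open>
  The blocks of a representation of \<open>T\<close> are determined by the three summands, so the
  representation with respect to \<open>S1\<close>, \<open>S0\<close>, \<open>S2\<close> is the canonical one if these are the
  canonical summands.  The degree \<open>d\<close> of the characteristic function is unique.
\<close>

definition canonical_representation ::
    "('a::complex_hilbert \<Rightarrow> 'a) \<Rightarrow> nat \<Rightarrow> 'a set \<Rightarrow> 'a set \<Rightarrow> 'a set \<Rightarrow> bool" where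
  "canonical_representation T d S1 S0 S2 \<longleftrightarrow>
     completely_non_unitary T \<and>
     op_polynomial (defect_space T) (defect_space (cadjoint T)) (char_fun T) d \<and>
     upper_triangular_rep T S1 S0 S2 \<and>
     S1 = canonical_space_1 T d \<and>
     S0 = canonical_space_0 T d \<and>
     S2 = canonical_space_minus1 T"


section \<open>The space of \<open>T\<^sub>A\<close>\<close>

lemma sq_summable_add:
  fixes f g :: "'i \<Rightarrow> 'a::real_normed_vector"
  assumes "(\<lambda>n. (norm (f n))\<^sup>2) summable_on UNIV" "(\<lambda>n. (norm (g n))\<^sup>2) summable_on UNIV"
  shows "(\<lambda>n. (norm (f n + g n))\<^sup>2) summable_on UNIV"
proof (rule summable_on_comparison_test)
  show "(\<lambda>n. 2 * (norm (f n))\<^sup>2 + 2 * (norm (g n))\<^sup>2) summable_on UNIV"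
    by (intro summable_on_add summable_on_cmult_right assms)
  fix n
  have "(norm (f n + g n))\<^sup>2 \<le> (norm (f n) + norm (g n))\<^sup>2"
    by (intro power_mono norm_triangle_ineq) simp
  also have "\<dots> \<le> 2 * (norm (f n))\<^sup>2 + 2 * (norm (g n))\<^sup>2"
    using sum_squares_bound[of "norm (f n)" "norm (g n)"] by (simp add: power2_sum)
  finally show "(norm (f n + g n))\<^sup>2 \<le> 2 * (norm (f n))\<^sup>2 + 2 * (norm (g n))\<^sup>2" .
qed simp

lemma sq_summable_scaleC:
  fixes f :: "'i \<Rightarrow> 'a::complex_inner"
  assumes "(\<lambda>n. (norm (f n))\<^sup>2) summable_on UNIV"
  shows "(\<lambda>n. (norm (a *\<^sub>C f n))\<^sup>2) summable_on UNIV"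
  unfolding norm_scaleC power_mult_distrib by (intro summable_on_cmult_right assms)

lemma cinner_summable:
  fixes f g :: "'i \<Rightarrow> 'a::complex_inner"
  assumes "(\<lambda>n. (norm (f n))\<^sup>2) summable_on UNIV" "(\<lambda>n. (norm (g n))\<^sup>2) summable_on UNIV"
  shows "(\<lambda>n. cinner (f n) (g n)) summable_on UNIV"
proof (rule abs_summable_summable, rule summable_on_comparison_test)
  show "(\<lambda>n. (norm (f n))\<^sup>2 + (norm (g n))\<^sup>2) summable_on UNIV"
    by (intro summable_on_add assms)
  fix n
  have "0 \<le> norm (f n) * norm (g n)"
    by simp
  then have "norm (f n) * norm (g n) \<le> (norm (f n))\<^sup>2 + (norm (g n))\<^sup>2"
    using sum_squares_bound[of "norm (f n)" "norm (g n)"] by linarith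
  with cmod_cinner_le[of "f n" "g n"]
  show "norm (cinner (f n) (g n)) \<le> (norm (f n))\<^sup>2 + (norm (g n))\<^sup>2"
    by linarith
qed simp

text \<open>
  The Hilbert space direct sum of the \<open>\<L>\<^sub>n\<close>, \<open>n \<in> \<int>\<close>, with \<open>\<L>\<^sub>n = 'n\<close> for \<open>n \<ge> 0\<close> and
  \<open>\<L>\<^sub>n = 'm\<close> for \<open>n < 0\<close>.  As all coordinates need a common type, \<open>\<L>\<^sub>n\<close> is realised as
  \<open>{0} \<times> 'n\<close> respectively \<open>'m \<times> {0}\<close> inside \<open>'m \<times> 'n\<close>.
\<close>

typedef (overloaded) ('m, 'n) bilateral_sum =
  "{f :: int \<Rightarrow> 'm::complex_inner \<times> 'n::complex_inner.
      (\<forall>n\<ge>0. fst (f n) = 0) \<and> (\<forall>n<0. snd (f n) = 0) \<and>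
      (\<lambda>n. (norm (f n))\<^sup>2) summable_on UNIV}"
  morphisms coord Abs_bilateral_sum
  by (rule exI[of _ "\<lambda>_. 0"]) simp

setup_lifting type_definition_bilateral_sum

lemma coord_sq_summable: "(\<lambda>n. (norm (coord h n))\<^sup>2) summable_on UNIV"
  using coord[of h] by simp

lemma bilateral_sum_eqI: "(\<And>n. coord h n = coord g n) \<Longrightarrow> h = g"
  by (metis coord_inject ext)

instantiation bilateral_sum :: (complex_inner, complex_inner) complex_vector
begin

lift_definition zero_bilateral_sum :: "('a, 'b) bilateral_sum" is "\<lambda>_. 0"
  by simp

lift_definition plus_bilateral_sum ::
    "('a, 'b) bilateral_sum \<Rightarrow> ('a, 'b) bilateral_sum \<Rightarrow> ('a, 'b) bilateral_sum"
  is "\<lambda>f g n. f n + g n"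
  using sq_summable_add by auto

lift_definition uminus_bilateral_sum :: "('a, 'b) bilateral_sum \<Rightarrow> ('a, 'b) bilateral_sum"
  is "\<lambda>f n. - f n"
  by simp

lift_definition scaleC_bilateral_sum ::
    "complex \<Rightarrow> ('a, 'b) bilateral_sum \<Rightarrow> ('a, 'b) bilateral_sum"
  is "\<lambda>a f n. a *\<^sub>C f n"
  by (auto simp: sq_summable_scaleC) (auto simp: scaleC_prod_def)

definition minus_bilateral_sum ::
    "('a, 'b) bilateral_sum \<Rightarrow> ('a, 'b) bilateral_sum \<Rightarrow> ('a, 'b) bilateral_sum" where
  "minus_bilateral_sum h g = h + - g"

definition scaleR_bilateral_sum ::
    "real \<Rightarrow> ('a, 'b) bilateral_sum \<Rightarrow> ('a, 'b) bilateral_sum" where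
  "scaleR_bilateral_sum r h = complex_of_real r *\<^sub>C h"

lemma coord_simps [simp]:
  fixes h g :: "('a, 'b) bilateral_sum"
  shows "coord (0 :: ('a, 'b) bilateral_sum) n = 0"
    and "coord (h + g) n = coord h n + coord g n"
    and "coord (- h) n = - coord h n"
    and "coord (a *\<^sub>C h) n = a *\<^sub>C coord h n"
    and "coord (h - g) n = coord h n - coord g n"
    and "coord (r *\<^sub>R h) n = r *\<^sub>R coord h n"
  unfolding minus_bilateral_sum_def scaleR_bilateral_sum_def scaleR_scaleC[of r "coord h n"]
  by (transfer; simp)+

instance
proof
  fix h g k :: "('a, 'b) bilateral_sum" and a b :: complex and r s :: real
  show "h + g + k = h + (g + k)"
    by (rule bilateral_sum_eqI) (simp add: add.assoc)
  show "h + g = g + h"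
    by (rule bilateral_sum_eqI) (simp add: add.commute)
  show "0 + h = h" "- h + h = 0" "h - g = h + - g"
    by (rule bilateral_sum_eqI, simp)+
  show "r *\<^sub>R (h + g) = r *\<^sub>R h + r *\<^sub>R g" "(r + s) *\<^sub>R h = r *\<^sub>R h + s *\<^sub>R h"
    "r *\<^sub>R s *\<^sub>R h = (r * s) *\<^sub>R h" "1 *\<^sub>R h = h"
    by (rule bilateral_sum_eqI, simp add: scaleR_add_right scaleR_add_left)+
  show "a *\<^sub>C (h + g) = a *\<^sub>C h + a *\<^sub>C g" "(a + b) *\<^sub>C h = a *\<^sub>C h + b *\<^sub>C h"
    "a *\<^sub>C b *\<^sub>C h = (a * b) *\<^sub>C h" "1 *\<^sub>C h = h"
    by (rule bilateral_sum_eqI,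
        simp add: scaleC_add_right scaleC_add_left scaleC_scaleC scaleC_one)+
  show "r *\<^sub>R h = complex_of_real r *\<^sub>C h"
    by (rule scaleR_bilateral_sum_def)
qed

end

instantiation bilateral_sum :: (complex_inner, complex_inner) complex_inner
begin

definition cinner_bilateral_sum ::
    "('a, 'b) bilateral_sum \<Rightarrow> ('a, 'b) bilateral_sum \<Rightarrow> complex" where
  "cinner_bilateral_sum h g = (\<Sum>\<^sub>\<infinity>n. cinner (coord h n) (coord g n))"

definition inner_bilateral_sum ::
    "('a, 'b) bilateral_sum \<Rightarrow> ('a, 'b) bilateral_sum \<Rightarrow> real" where
  "inner_bilateral_sum h g = Re (cinner h g)"

definition norm_bilateral_sum :: "('a, 'b) bilateral_sum \<Rightarrow> real" where
  "norm_bilateral_sum h = sqrt (inner h h)"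

definition sgn_bilateral_sum :: "('a, 'b) bilateral_sum \<Rightarrow> ('a, 'b) bilateral_sum" where
  "sgn_bilateral_sum h = inverse (norm h) *\<^sub>R h"

definition dist_bilateral_sum ::
    "('a, 'b) bilateral_sum \<Rightarrow> ('a, 'b) bilateral_sum \<Rightarrow> real" where
  "dist_bilateral_sum h g = norm (h - g)"

definition uniformity_bilateral_sum ::
    "(('a, 'b) bilateral_sum \<times> ('a, 'b) bilateral_sum) filter" where
  "uniformity_bilateral_sum = (INF e\<in>{0 <..}. principal {(h, g). dist h g < e})"

definition open_bilateral_sum :: "('a, 'b) bilateral_sum set \<Rightarrow> bool" where
  "open_bilateral_sum S =
     (\<forall>h\<in>S. \<forall>\<^sub>F (h', g) in uniformity. h' = h \<longrightarrow> g \<in> S)"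

lemma inner_self_bilateral_sum:
  "inner h h = (\<Sum>\<^sub>\<infinity>n. (norm (coord h n))\<^sup>2)" for h :: "('a, 'b) bilateral_sum"
proof -
  have "inner h h = (\<Sum>\<^sub>\<infinity>n. Re (cinner (coord h n) (coord h n)))"
    unfolding inner_bilateral_sum_def cinner_bilateral_sum_def
    by (rule infsum_Re[symmetric]) (intro cinner_summable coord_sq_summable)
  then show ?thesis
    unfolding cinner_self Re_complex_of_real .
qed

instance
proof
  fix h g k :: "('a, 'b) bilateral_sum" and a :: complex and r :: real
    and S :: "('a, 'b) bilateral_sum set"
  show comm: "cinner h g = cnj (cinner g h)" for h g :: "('a, 'b) bilateral_sum"
    unfolding cinner_bilateral_sum_def infsum_cnj[symmetric]
    by (intro infsum_cong cinner_commute)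
  show add: "cinner (h + g) k = cinner h k + cinner g k"
    unfolding cinner_bilateral_sum_def coord_simps cinner_add_left
    by (intro infsum_add cinner_summable coord_sq_summable)
  show scale: "cinner (a *\<^sub>C h) g = a * cinner h g" for a
    unfolding cinner_bilateral_sum_def coord_simps cinner_scaleC_left
    by (rule infsum_cmult_right')
  show "Re (cinner h g) = inner h g"
    by (simp add: inner_bilateral_sum_def)
  show "inner h g = inner g h"
    unfolding inner_bilateral_sum_def by (subst comm) simp
  show "inner (h + g) k = inner h k + inner g k"
    by (simp add: inner_bilateral_sum_def add)
  show "inner (r *\<^sub>R h) g = r * inner h g"
    by (simp add: inner_bilateral_sum_def scaleR_bilateral_sum_def scale)
  show nonneg: "0 \<le> inner h h"
    unfolding inner_self_bilateral_sum by (rule infsum_nonneg) simp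
  show "inner h h = 0 \<longleftrightarrow> h = 0"
  proof
    assume "inner h h = 0"
    then have "(\<Sum>\<^sub>\<infinity>n. (norm (coord h n))\<^sup>2) \<le> 0"
      unfolding inner_self_bilateral_sum by (rule eq_refl)
    then have "(norm (coord h n))\<^sup>2 = 0" for n
      by (rule nonneg_infsum_le_0D[OF _ coord_sq_summable]) (rule zero_le_power2, rule UNIV_I)
    then show "h = 0"
      by (intro bilateral_sum_eqI) simp
  qed (simp add: inner_self_bilateral_sum)
  show "norm h = sqrt (inner h h)"
    by (rule norm_bilateral_sum_def)
  show "sgn h = inverse (norm h) *\<^sub>R h"
    by (rule sgn_bilateral_sum_def)
  show "dist h g = norm (h - g)"
    by (rule dist_bilateral_sum_def)
  show "uniformity = (INF e\<in>{0 <..}. principal {(h::('a, 'b) bilateral_sum, g). dist h g < e})"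
    by (rule uniformity_bilateral_sum_def)
  show "open S = (\<forall>h\<in>S. \<forall>\<^sub>F (h', g) in uniformity. h' = h \<longrightarrow> g \<in> S)"
    by (rule open_bilateral_sum_def)
qed

end

lemma norm_bilateral_sum: "(norm h)\<^sup>2 = (\<Sum>\<^sub>\<infinity>n. (norm (coord h n))\<^sup>2)"
  unfolding inner_self_bilateral_sum[symmetric] by (rule power2_norm_eq_inner)

lemma sum_norm_coord_le:
  assumes "finite F"
  shows "(\<Sum>n\<in>F. (norm (coord h n))\<^sup>2) \<le> (norm h)\<^sup>2"
  unfolding norm_bilateral_sum using assms
  by (intro finite_sum_le_infsum coord_sq_summable) auto

lemma norm_coord_le: "norm (coord h n) \<le> norm h"
  using sum_norm_coord_le[of "{n}" h] by (simp add: power2_le_iff_abs_le)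

lemma bilateral_sum_limit:
  fixes X :: "nat \<Rightarrow> ('m::complex_hilbert, 'n::complex_hilbert) bilateral_sum"
  assumes "Cauchy X"
  shows "\<exists>L. X \<longlonglongrightarrow> L"
proof -
  have Cauchy_coord: "Cauchy (\<lambda>i. coord (X i) n)" for n
  proof (rule metric_CauchyI)
    fix e :: real
    assume "e > 0"
    then obtain N where "\<forall>i\<ge>N. \<forall>j\<ge>N. dist (X i) (X j) < e"
      using assms by (meson metric_CauchyD)
    moreover have "dist (coord (X i) n) (coord (X j) n) \<le> dist (X i) (X j)" for i j
      using norm_coord_le[of "X i - X j" n] by (simp add: dist_norm)
    ultimately show "\<exists>N. \<forall>i\<ge>N. \<forall>j\<ge>N. dist (coord (X i) n) (coord (X j) n) < e"
      by (meson le_less_trans)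
  qed
  define l where "l n = lim (\<lambda>i. coord (X i) n)" for n
  have l: "(\<lambda>i. coord (X i) n) \<longlonglongrightarrow> l n" for n
    unfolding l_def using Cauchy_coord[of n]
    by (simp add: Cauchy_convergent_iff convergent_LIMSEQ_iff)
  have partial: "(\<Sum>n\<in>F. (norm (l n - coord (X i) n))\<^sup>2) \<le> e\<^sup>2"
    if "finite F" and e: "\<And>j. j \<ge> i \<Longrightarrow> norm (X j - X i) \<le> e" for F i e
  proof (rule LIMSEQ_le_const2)
    show "(\<lambda>j. \<Sum>n\<in>F. (norm (coord (X j) n - coord (X i) n))\<^sup>2)
            \<longlonglongrightarrow> (\<Sum>n\<in>F. (norm (l n - coord (X i) n))\<^sup>2)"
      by (intro tendsto_sum tendsto_power tendsto_norm tendsto_diff l tendsto_const)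
    show "\<exists>N. \<forall>j\<ge>N. (\<Sum>n\<in>F. (norm (coord (X j) n - coord (X i) n))\<^sup>2) \<le> e\<^sup>2"
    proof (intro exI allI impI)
      fix j
      assume "i \<le> j"
      then have "(norm (X j - X i))\<^sup>2 \<le> e\<^sup>2"
        using e by (intro power_mono) auto
      then show "(\<Sum>n\<in>F. (norm (coord (X j) n - coord (X i) n))\<^sup>2) \<le> e\<^sup>2"
        using sum_norm_coord_le[OF \<open>finite F\<close>, of "X j - X i"] by simp
    qed
  qed
  have tail: "\<exists>N. \<forall>i\<ge>N. \<forall>j\<ge>i. norm (X j - X i) \<le> e" if "e > 0" for e
    using metric_CauchyD[OF assms that] unfolding dist_norm
    by (meson less_imp_le order_trans)
  have sq_diff: "(\<lambda>n. (norm (l n - coord (X i) n))\<^sup>2) summable_on UNIV"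
    if "\<And>j. j \<ge> i \<Longrightarrow> norm (X j - X i) \<le> e" for i e
    using partial[OF _ that]
    by (intro nonneg_bdd_above_summable_on) (auto intro!: bdd_aboveI[where M = "e\<^sup>2"])
  obtain N where "\<forall>i\<ge>N. \<forall>j\<ge>i. norm (X j - X i) \<le> 1"
    using tail[of 1] by auto
  then have "(\<lambda>n. (norm (l n - coord (X N) n))\<^sup>2) summable_on UNIV"
    by (intro sq_diff[where e = 1]) auto
  from sq_summable_add[OF this coord_sq_summable[of "X N"]]
  have "(\<lambda>n. (norm (l n))\<^sup>2) summable_on UNIV"
    by simp
  moreover have "fst (l n) = 0" if "n \<ge> 0" for n
  proof -
    have "fst (coord (X i) n) = 0" for i
      using coord[of "X i"] that by simp
    then show ?thesis
      using tendsto_fst[OF l[of n]] by (simp add: LIMSEQ_const_iff)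
  qed
  moreover have "snd (l n) = 0" if "n < 0" for n
  proof -
    have "snd (coord (X i) n) = 0" for i
      using coord[of "X i"] that by simp
    then show ?thesis
      using tendsto_snd[OF l[of n]] by (simp add: LIMSEQ_const_iff)
  qed
  ultimately have L: "coord (Abs_bilateral_sum l) = l"
    by (intro Abs_bilateral_sum_inverse) auto
  have "X \<longlonglongrightarrow> Abs_bilateral_sum l"
  proof (rule metric_LIMSEQ_I)
    fix e :: real
    assume "e > 0"
    then obtain N where N: "\<forall>i\<ge>N. \<forall>j\<ge>i. norm (X j - X i) \<le> e / 2"
      using tail[of "e / 2"] by auto
    have "dist (X i) (Abs_bilateral_sum l) < e" if "i \<ge> N" for i
    proof -
      have i: "\<And>j. j \<ge> i \<Longrightarrow> norm (X j - X i) \<le> e / 2"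
        using N that by auto
      have "(norm (Abs_bilateral_sum l - X i))\<^sup>2 \<le> (e / 2)\<^sup>2"
        unfolding norm_bilateral_sum coord_simps L
        by (intro infsum_le_finite_sums sq_diff[where e = "e / 2"] partial i)
      then have "norm (Abs_bilateral_sum l - X i) \<le> e / 2"
        using \<open>e > 0\<close> by (simp add: power2_le_iff_abs_le)
      then show ?thesis
        using \<open>e > 0\<close> by (simp add: dist_norm norm_minus_commute)
    qed
    then show "\<exists>N. \<forall>i\<ge>N. dist (X i) (Abs_bilateral_sum l) < e"
      by blast
  qed
  then show ?thesis ..
qed

instance bilateral_sum :: (complex_hilbert, complex_hilbert) complex_hilbert
proof
  fix X :: "nat \<Rightarrow> ('a, 'b) bilateral_sum"
  show "Cauchy X \<Longrightarrow> convergent X"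
    unfolding convergent_def by (rule bilateral_sum_limit)
qed

text \<open>The subspace \<open>\<Oplus>\<^bsub>n\<in>I\<^esub> \<L>\<^sub>n\<close>.\<close>

definition summands :: "int set \<Rightarrow> ('m::complex_inner, 'n::complex_inner) bilateral_sum set" where
  "summands I = {h. \<forall>n. n \<notin> I \<longrightarrow> coord h n = 0}"

text \<open>The inclusions of \<open>\<L>\<^sub>n\<close> into the sum, for \<open>n \<ge> 0\<close> and for \<open>n < 0\<close>.\<close>

lift_definition incl_nonneg ::
    "nat \<Rightarrow> 'n \<Rightarrow> ('m::complex_inner, 'n::complex_inner) bilateral_sum"
  is "\<lambda>n x k. if k = int n then (0, x) else 0"
  by (auto intro!: finite_nonzero_values_imp_summable_on intro: finite_subset[of _ "{int n}" for n])

lift_definition incl_neg ::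
    "int \<Rightarrow> 'm \<Rightarrow> ('m::complex_inner, 'n::complex_inner) bilateral_sum"
  is "\<lambda>n x k. if k = n \<and> n < 0 then (x, 0) else 0"
  by (auto intro!: finite_nonzero_values_imp_summable_on intro: finite_subset[of _ "{n}" for n])

lemma sq_summable_shift:
  fixes f g :: "int \<Rightarrow> 'a::real_normed_vector"
  assumes f: "(\<lambda>n. (norm (f n))\<^sup>2) summable_on UNIV"
    and F: "finite F" and eq: "\<And>n. n \<notin> F \<Longrightarrow> g n = f (n - 1)"
  shows "(\<lambda>n. (norm (g n))\<^sup>2) summable_on UNIV"
proof -
  have bij: "bij_betw (\<lambda>n::int. n - 1) UNIV UNIV"
    by (rule bij_betw_byWitness[where f' = "\<lambda>n. n + 1"]) auto
  have "(\<lambda>n. (norm (f (n - 1)))\<^sup>2) summable_on UNIV"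
    using summable_on_reindex_bij_betw[OF bij, of "\<lambda>n. (norm (f n))\<^sup>2"] f by simp
  then have "(\<lambda>n. (norm (f (n - 1)))\<^sup>2) summable_on - F"
    by (rule summable_on_subset) simp
  then have "(\<lambda>n. (norm (g n))\<^sup>2) summable_on - F"
    by (rule summable_on_cong[THEN iffD1, rotated]) (simp add: eq)
  then have "(\<lambda>n. (norm (g n))\<^sup>2) summable_on (- F \<union> F)"
    by (rule summable_on_Un_disjoint) (use F in auto)
  then show ?thesis
    by (simp add: Un_commute)
qed

text \<open>
  \<open>T\<^sub>A\<close> in coordinates: \<open>\<L>\<^sub>0\<close> receives nothing (as \<open>m \<ge> 1\<close>), \<open>\<L>\<^sub>m\<close> receives the images of
  \<open>\<L>\<^bsub>m-1\<^esub>\<close> and \<open>\<L>\<^bsub>-1\<^esub>\<close>, and every other \<open>\<L>\<^sub>k\<close> receives \<open>\<L>\<^bsub>k-1\<^esub>\<close>.  The lemmas below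
  give the restrictions to the summands.
\<close>

lift_definition T_A ::
    "nat \<Rightarrow> ('m \<Rightarrow> 'n) \<Rightarrow>
     ('m::complex_hilbert, 'n::complex_hilbert) bilateral_sum \<Rightarrow> ('m, 'n) bilateral_sum"
  is "\<lambda>m A h k.
        if k = 0 then 0
        else if k = int m then
          (0, defect_op (cadjoint A) (snd (h (int m - 1))) - A (fst (h (- 1))))
        else h (k - 1)"
  subgoal for m A h
    by (auto intro!: sq_summable_shift[where f = h and F = "{0, int m}"]
        split: if_splits)
  done

context
  fixes A :: "'m::complex_hilbert \<Rightarrow> 'n::complex_hilbert" and m :: nat
  assumes m: "m \<ge> 1" and A: "A 0 = 0" and D: "defect_op (cadjoint A) 0 = 0"
begin

lemma T_A_incl_nonneg:
  assumes "n \<noteq> m - 1"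
  shows "T_A m A (incl_nonneg n x) = incl_nonneg (n + 1) x"
proof -
  have "int m \<noteq> 1 + int n" "int m - 1 \<noteq> int n"
    using assms m by auto
  then show ?thesis
    by (intro bilateral_sum_eqI) (auto simp: T_A.rep_eq incl_nonneg.rep_eq A D zero_prod_def)
qed

lemma T_A_incl_pred:
  "T_A m A (incl_nonneg (m - 1) x) = incl_nonneg m (defect_op (cadjoint A) x)"
  using m by (intro bilateral_sum_eqI)
    (auto simp: T_A.rep_eq incl_nonneg.rep_eq A zero_prod_def)

lemma T_A_incl_minus1: "T_A m A (incl_neg (- 1) x) = incl_nonneg m (- A x)"
  using m by (intro bilateral_sum_eqI)
    (auto simp: T_A.rep_eq incl_nonneg.rep_eq incl_neg.rep_eq D zero_prod_def)

lemma T_A_incl_neg: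
  assumes "n < - 1"
  shows "T_A m A (incl_neg n x) = incl_neg (n + 1) x"
  using m assms by (intro bilateral_sum_eqI)
    (auto simp: T_A.rep_eq incl_neg.rep_eq A D zero_prod_def)

end

end

theory Submission
  imports Defs
begin

text \<open>
  Write \<open>T\<close> for \<open>T\<^sub>A\<close> and \<open>D = (I - AA*)^(1/2)\<close>.  The adjoint of \<open>T\<close> shifts all coordinates one step
  towards \<open>-\<infinity>\<close>, except that it sends \<open>y \<in> \<L>\<^sub>m\<close> to \<open>D y \<in> \<L>\<^bsub>m-1\<^esub>\<close> plus \<open>- A* y \<in> \<L>\<^bsub>-1\<^esub>\<close> and
  kills \<open>\<L>\<^sub>0\<close>.  As \<open>D\<^sup>2 + AA* = I\<close>, the product \<open>T T*\<close> is the projection onto the complement of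
  \<open>\<L>\<^sub>0\<close> (\<open>T_Ts\<close>).  Almost everything follows from this identity.  First, \<open>T\<close> is a partial isometry,
  its defect operators are the projections onto \<open>ker T\<close> and \<open>\<L>\<^sub>0\<close>, and the defect spaces are these
  two subspaces.

  A vector of \<open>ker T\<close> has coordinates only at \<open>m - 1\<close> and \<open>- 1\<close>.  The intertwining relation
  \<open>A D\<^sub>A = D A\<close> shows that \<open>u \<mapsto> (A u, D\<^sub>A u)\<close> is a unitary map of \<open>\<M>\<close> onto \<open>ker T\<close>
  (\<open>ker_param\<close>, with inverse \<open>ker_coord\<close>).  On \<open>ker T\<close> the characteristic function reduces to \<open>z\<close>
  times the \<open>\<L>\<^sub>0\<close>-coordinate of \<open>(I - zT*)\<^sup>-\<^sup>1 h\<close>, and only the coordinate \<open>A u \<in> \<L>\<^bsub>m-1\<^esub>\<close> ever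
  reaches \<open>\<L>\<^sub>0\<close>, after \<open>m - 1\<close> backward shifts.  The value is therefore \<open>z\<^sup>m A u\<close>
  (\<open>resolvent_coord_0\<close>, \<open>char_fun_T\<close>).

  Purity of \<open>A\<close> enters through the injectivity of \<open>D\<close>: \<open>D y = 0\<close> means \<open>A A* y = y\<close>, which is
  impossible for a pure contraction unless \<open>y = 0\<close>.  Consequently a vector whose backward orbit
  \<open>T*\<^sup>k h\<close> has no component in \<open>\<L>\<^sub>0\<close> lies in the negative summands (\<open>summands_neg_if\<close>).  As
  \<open>\<parallel>T* h\<parallel>\<^sup>2 = \<parallel>h\<parallel>\<^sup>2 - \<parallel>h\<^sub>0\<parallel>\<^sup>2\<close>, this identifies the last canonical space; it also restricts a
  reducing subspace on which \<open>T\<close> is unitary to the negative summands, where the isometry property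
  removes one coordinate after the other.  The first canonical space is spanned by copies of
  \<open>Ran D\<close> in the \<open>\<L>\<^sub>j\<close>, \<open>j \<ge> m\<close>, and the range of \<open>D\<close> is dense because \<open>D\<close> is self-adjoint and
  injective.

  Adjoints come from the projection theorem (\<open>orthogonal_projection_exists\<close>), and the square root
  of \<open>I - B\<close> is the limit of an iteration that converges in norm (locale \<open>symmetric_contraction\<close>);
  the intertwining relation is visible on the iterates.
\<close>

section \<open>Orthogonal projection and adjoints\<close>

lemma subspace_closure:
  fixes W :: "'a::real_normed_vector set"
  assumes "subspace W"
  shows "subspace (closure W)"
  unfolding subspace_def
proof (intro conjI ballI allI)
  show "0 \<in> closure W"
    using assms closure_subset subspace_0 by blast
  fix x y and r :: real
  assume x: "x \<in> closure W"
  then obtain f where f: "\<And>n. f n \<in> W" "f \<longlonglongrightarrow> x"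
    unfolding closure_sequential by blast
  show "r *\<^sub>R x \<in> closure W"
    unfolding closure_sequential using f assms
    by (intro exI[of _ "\<lambda>n. r *\<^sub>R f n"]) (auto intro: tendsto_intros subspace_mul)
  assume "y \<in> closure W"
  then obtain g where g: "\<And>n. g n \<in> W" "g \<longlonglongrightarrow> y"
    unfolding closure_sequential by blast
  show "x + y \<in> closure W"
    unfolding closure_sequential using f g assms
    by (intro exI[of _ "\<lambda>n. f n + g n"]) (auto intro: tendsto_intros subspace_add)
qed

lemma nearest_point_exists:
  fixes W :: "'a::{real_inner,complete_space} set"
  assumes "subspace W" "closed W"
  shows "\<exists>w\<in>W. \<forall>v\<in>W. norm (x - w) \<le> norm (x - v)"
proof -
  have ne: "W \<noteq> {}"
    using assms(1) subspace_0 by blast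
  define d where "d = infdist x W"
  have d_le: "d \<le> norm (x - v)" if "v \<in> W" for v
    using infdist_le[OF that, of x] by (simp add: d_def dist_norm)
  have d0: "d \<ge> 0"
    by (simp add: d_def infdist_nonneg)
  have "\<exists>w\<in>W. norm (x - w) < d + e" if "e > 0" for e
  proof -
    have "(INF a\<in>W. dist x a) < d + e"
      using that ne by (simp add: d_def infdist_def)
    then show ?thesis
      by (subst (asm) cINF_less_iff) (use ne in \<open>auto simp: dist_norm intro!: bdd_belowI[where m=0]\<close>)
  qed
  then have "\<forall>i. \<exists>w\<in>W. norm (x - w) < d + 1 / real (Suc i)"
    by simp
  then obtain w where w: "\<And>i. w i \<in> W" "\<And>i. norm (x - w i) < d + 1 / real (Suc i)"
    by metis
  \<comment> \<open>The midpoint of two points of the sequence lies in \<open>W\<close>, so its distance to \<open>x\<close> is at least \<open>d\<close>;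
    the parallelogram law then bounds the distance of the two points.\<close>
  have close: "(norm (w i - w j))\<^sup>2 \<le> 2 * (norm (x - w i))\<^sup>2 + 2 * (norm (x - w j))\<^sup>2 - 4 * d\<^sup>2" for i j
  proof -
    have mid: "(1/2) *\<^sub>R (w i + w j) \<in> W"
      using assms(1) w(1) by (simp add: subspace_add subspace_mul)
    have "d\<^sup>2 \<le> (norm (x - (1/2) *\<^sub>R (w i + w j)))\<^sup>2"
      using d_le[OF mid] d0 by (intro power_mono)
    moreover have "(norm (w i - w j))\<^sup>2 + 4 * (norm (x - (1/2) *\<^sub>R (w i + w j)))\<^sup>2 =
        2 * (norm (x - w i))\<^sup>2 + 2 * (norm (x - w j))\<^sup>2"
      by (simp add: power2_norm_eq_inner inner_commute algebra_simps)
    ultimately show ?thesis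
      by linarith
  qed
  have lim: "(\<lambda>i. norm (x - w i)) \<longlonglongrightarrow> d"
  proof (rule real_tendsto_sandwich[of "\<lambda>_. d" _ _ "\<lambda>i. d + 1 / real (Suc i)"])
    show "(\<lambda>i. d + 1 / real (Suc i)) \<longlonglongrightarrow> d"
      using tendsto_add[OF tendsto_const[of d] LIMSEQ_inverse_real_of_nat]
      by (simp add: inverse_eq_divide)
    show "\<forall>\<^sub>F i in sequentially. norm (x - w i) \<le> d + 1 / real (Suc i)"
      using w(2) by (intro always_eventually allI less_imp_le)
  qed (use d_le w(1) in auto)
  have "Cauchy w"
  proof (rule metric_CauchyI)
    fix e :: real assume e: "e > 0"
    have "(\<lambda>i. (norm (x - w i))\<^sup>2) \<longlonglongrightarrow> d\<^sup>2"
      by (intro tendsto_power lim)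
    then have "\<forall>\<^sub>F i in sequentially. (norm (x - w i))\<^sup>2 < d\<^sup>2 + e\<^sup>2 / 4"
      by (rule order_tendstoD) (use e in simp)
    then obtain N where N: "\<And>i. i \<ge> N \<Longrightarrow> (norm (x - w i))\<^sup>2 < d\<^sup>2 + e\<^sup>2 / 4"
      by (auto simp: eventually_sequentially)
    have "dist (w i) (w j) < e" if "i \<ge> N" "j \<ge> N" for i j
    proof -
      have "(norm (w i - w j))\<^sup>2 < e\<^sup>2"
        using close[of i j] N[OF that(1)] N[OF that(2)] by linarith
      then show ?thesis
        using e by (simp add: dist_norm power2_less_imp_less)
    qed
    then show "\<exists>N. \<forall>i\<ge>N. \<forall>j\<ge>N. dist (w i) (w j) < e"
      by blast
  qed
  then obtain l where l: "w \<longlonglongrightarrow> l"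
    using Cauchy_convergent_iff convergent_def by blast
  have "l \<in> W"
    using assms(2) l w(1) closed_sequentially by blast
  moreover have "norm (x - l) = d"
    using tendsto_norm[OF tendsto_diff[OF tendsto_const[of x] l]] lim LIMSEQ_unique by blast
  ultimately show ?thesis
    using d_le by auto
qed

text \<open>The error of the best approximation is orthogonal to \<open>W\<close>, since moving along \<open>v \<in> W\<close> cannot decrease it.\<close>

lemma orthogonal_projection_exists:
  fixes W :: "'a::{real_inner,complete_space} set"
  assumes "subspace W" "closed W"
  shows "\<exists>w\<in>W. \<forall>v\<in>W. inner (x - w) v = 0"
proof -
  obtain w where w: "w \<in> W" and min: "\<And>v. v \<in> W \<Longrightarrow> norm (x - w) \<le> norm (x - v)"
    using nearest_point_exists[OF assms] by blast
  have "inner (x - w) v = 0" if v: "v \<in> W" for v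
  proof (rule ccontr)
    assume nz: "inner (x - w) v \<noteq> 0"
    then have v0: "inner v v > 0"
      by (metis inner_gt_zero_iff inner_zero_right)
    define t where "t = inner (x - w) v / inner v v"
    have "w + t *\<^sub>R v \<in> W"
      using assms(1) w v by (simp add: subspace_add subspace_mul)
    then have "(norm (x - w))\<^sup>2 \<le> (norm ((x - w) - t *\<^sub>R v))\<^sup>2"
      using min by (intro power_mono) (simp_all add: diff_diff_eq)
    also have "\<dots> = (norm (x - w))\<^sup>2 - 2 * t * inner (x - w) v + t\<^sup>2 * inner v v"
      unfolding power2_norm_eq_inner
      by (simp add: inner_diff_left inner_diff_right inner_commute power2_eq_square)
    also have "\<dots> = (norm (x - w))\<^sup>2 - (inner (x - w) v)\<^sup>2 / inner v v"
      using v0 by (simp add: t_def power2_eq_square field_simps)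
    also have "\<dots> < (norm (x - w))\<^sup>2"
      using nz v0 by simp
    finally show False by simp
  qed
  then show ?thesis using w by blast
qed

text \<open>The representing vector spans the orthogonal complement of the kernel.\<close>

lemma riesz_representation:
  fixes f :: "'a::{real_inner,complete_space} \<Rightarrow> real"
  assumes "bounded_linear f"
  shows "\<exists>z. \<forall>x. f x = inner x z"
proof (cases "\<forall>x. f x = 0")
  case True
  then show ?thesis by (intro exI[of _ 0]) simp
next
  case False
  interpret f: bounded_linear f by fact
  obtain x0 where x0: "f x0 \<noteq> 0" using False by blast
  have "subspace {x. f x = 0}"
    by (simp add: subspace_def f.add f.scaleR)
  moreover have "closed {x. f x = 0}"
    by (intro closed_Collect_eq continuous_intros f.continuous_on)
  ultimately obtain w where w: "f w = 0" and orth: "\<And>v. f v = 0 \<Longrightarrow> inner (x0 - w) v = 0"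
    using orthogonal_projection_exists[of "{x. f x = 0}" x0] by blast
  define v where "v = x0 - w"
  have fv: "f v \<noteq> 0"
    using x0 w by (simp add: v_def f.diff)
  then have v0: "inner v v \<noteq> 0"
    using f.zero by auto
  have "f x = inner x ((f v / inner v v) *\<^sub>R v)" for x
  proof -
    have "f (x - (f x / f v) *\<^sub>R v) = 0"
      using fv by (simp add: f.diff f.scaleR)
    from orth[OF this] have "inner x v = f x / f v * inner v v"
      by (simp add: v_def[symmetric] inner_diff_right inner_commute)
    then show ?thesis
      using fv v0 by simp
  qed
  then show ?thesis by blast
qed

lemma cinner_add_right: "cinner x (y + z) = cinner x y + cinner x z" for x :: "'a::complex_inner"
  by (metis cinner_commute cinner_add_left complex_cnj_add)

lemma cinner_zero [simp]: "cinner 0 x = 0" "cinner x 0 = 0" for x :: "'a::complex_inner"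
  using cinner_add_left[of 0 0 x] cinner_add_right[of x 0 0] by auto

lemma cinner_minus [simp]: "cinner (- x) y = - cinner x y" "cinner x (- y) = - cinner x y"
  for x :: "'a::complex_inner"
  using cinner_add_left[of x "- x" y] cinner_add_right[of x y "- y"]
  by (simp_all add: eq_neg_iff_add_eq_0 add.commute)

lemma cinner_diff_left: "cinner (x - y) z = cinner x z - cinner y z" for x :: "'a::complex_inner"
  using cinner_add_left[of x "- y" z] by simp

lemma cinner_diff_right: "cinner x (y - z) = cinner x y - cinner x z" for x :: "'a::complex_inner"
  using cinner_add_right[of x y "- z"] by simp

lemma cinner_eqI:
  fixes x y :: "'a::complex_inner"
  assumes "\<And>z. cinner z x = cinner z y"
  shows "x = y"
proof -
  have "cinner (x - y) (x - y) = 0"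
    using assms by (simp add: cinner_diff_right)
  then show ?thesis
    by (simp add: cinner_self)
qed

lemma scaleC_simps [simp]:
  fixes x y :: "'a::complex_inner"
  shows "a *\<^sub>C (0::'a) = 0" "0 *\<^sub>C x = 0" "1 *\<^sub>C x = x" "a *\<^sub>C (- x) = - (a *\<^sub>C x)"
    "a *\<^sub>C (x - y) = a *\<^sub>C x - a *\<^sub>C y" "a *\<^sub>C (b *\<^sub>C x) = (a * b) *\<^sub>C x"
  by (simp_all add: complex_vector.scale_right_diff_distrib scaleC_scaleC)

lemma bounded_clinearI:
  assumes "\<And>x y. f (x + y) = f x + f y" "\<And>a x. f (a *\<^sub>C x) = a *\<^sub>C f x"
    "\<And>x. norm (f x) \<le> K * norm x"
  shows "bounded_clinear f"
  unfolding bounded_clinear_def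
  using assms
  by (auto intro!: bounded_linear_intro[of _ K] simp: scaleR_scaleC mult.commute)

lemma bounded_clinear_bounded_linear: "bounded_clinear f \<Longrightarrow> bounded_linear f"
  by (simp add: bounded_clinear_def)

lemma bounded_clinear_simps:
  assumes "bounded_clinear f"
  shows "f (x + y) = f x + f y" "f (x - y) = f x - f y" "f (- x) = - f x" "f 0 = 0"
    "f (r *\<^sub>R x) = r *\<^sub>R f x" "f (a *\<^sub>C x) = a *\<^sub>C f x"
proof -
  interpret f: bounded_linear f using assms by (rule bounded_clinear_bounded_linear)
  show "f (x + y) = f x + f y" "f (x - y) = f x - f y" "f (- x) = - f x" "f 0 = 0"
    "f (r *\<^sub>R x) = r *\<^sub>R f x" "f (a *\<^sub>C x) = a *\<^sub>C f x"
    using assms by (simp_all add: f.add f.diff f.neg f.zero f.scaleR bounded_clinear_def)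
qed

lemma bounded_clinear_compose:
  "bounded_clinear f \<Longrightarrow> bounded_clinear g \<Longrightarrow> bounded_clinear (\<lambda>x. f (g x))"
  by (simp add: bounded_clinear_def bounded_linear_compose)

lemma bounded_clinear_diff:
  "bounded_clinear f \<Longrightarrow> bounded_clinear g \<Longrightarrow> bounded_clinear (\<lambda>x. f x - g x)"
  by (simp add: bounded_clinear_def bounded_linear_sub)

lemma bounded_clinear_ident: "bounded_clinear (\<lambda>x. x)"
  by (simp add: bounded_clinear_def bounded_linear_ident)

lemma bounded_clinear_scaleC: "bounded_clinear (\<lambda>x. a *\<^sub>C x)"
  by (intro bounded_clinearI[where K = "cmod a"])
    (simp_all add: scaleC_add_right norm_scaleC mult.commute)

text \<open>
  Riesz's theorem for the real part of \<open>x \<mapsto> \<langle>T x, y\<rangle>\<close> suffices: two complex linear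
  functionals with the same real part are equal.
\<close>

lemma adjoint_exists:
  fixes T :: "'a::complex_hilbert \<Rightarrow> 'b::complex_hilbert"
  assumes "bounded_clinear T"
  shows "\<exists>S. \<forall>x y. cinner (T x) y = cinner x (S y)"
proof -
  have "\<exists>z. \<forall>x. cinner (T x) y = cinner x z" for y
  proof -
    have "bounded_linear (\<lambda>x. inner (T x) y)"
      using assms by (intro bounded_linear_compose[OF bounded_linear_inner_left] bounded_clinear_bounded_linear)
    then obtain z where z: "\<And>x. inner (T x) y = inner x z"
      using riesz_representation by blast
    have "cinner (T x) y = cinner x z" for x
    proof (rule complex_eqI)
      show "Re (cinner (T x) y) = Re (cinner x z)"
        by (simp add: Re_cinner z)
      have "Re (\<i> * cinner (T x) y) = Re (\<i> * cinner x z)"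
        using z[of "\<i> *\<^sub>C x"] assms
        unfolding Re_cinner[symmetric] by (simp add: bounded_clinear_simps cinner_scaleC_left)
      then show "Im (cinner (T x) y) = Im (cinner x z)"
        by simp
    qed
    then show ?thesis by blast
  qed
  then show ?thesis by metis
qed

lemma cadjoint_eqI:
  assumes "\<And>x y. cinner (T x) y = cinner x (S y)"
  shows "cadjoint T = S"
  unfolding cadjoint_def
proof (rule the_equality)
  fix S' assume "\<forall>x y. cinner (T x) y = cinner x (S' y)"
  then show "S' = S"
    using assms by (metis cinner_eqI ext)
qed (use assms in simp)

lemma cinner_cadjoint:
  fixes T :: "'a::complex_hilbert \<Rightarrow> 'b::complex_hilbert"
  assumes "bounded_clinear T"
  shows "cinner (T x) y = cinner x (cadjoint T y)"
  using adjoint_exists[OF assms] cadjoint_eqI by metis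

lemma cinner_cadjoint':
  fixes T :: "'a::complex_hilbert \<Rightarrow> 'b::complex_hilbert"
  assumes "bounded_clinear T"
  shows "cinner (cadjoint T y) x = cinner y (T x)"
  using cinner_cadjoint[OF assms] by (metis cinner_commute)

lemma cadjoint_cadjoint:
  fixes T :: "'a::complex_hilbert \<Rightarrow> 'b::complex_hilbert"
  assumes "bounded_clinear T"
  shows "cadjoint (cadjoint T) = T"
  using cadjoint_eqI cinner_cadjoint'[OF assms] by blast

text \<open>
  A pair of mutually adjoint maps is automatically linear, and the bound passes from one map to
  the other.
\<close>

lemma contraction_if_adjoint:
  fixes T :: "'a::complex_inner \<Rightarrow> 'b::complex_inner"
  assumes adj: "\<And>x y. cinner (T x) y = cinner x (S y)" and S: "\<And>y. norm (S y) \<le> norm y"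
  shows "contraction T"
proof -
  have le: "norm (T x) \<le> norm x" for x
  proof -
    have "(norm (T x))\<^sup>2 = cmod (cinner (T x) (T x))"
      unfolding cinner_self norm_of_real by simp
    also have "\<dots> \<le> norm x * norm (S (T x))"
      unfolding adj by (rule cmod_cinner_le)
    also have "\<dots> \<le> norm x * norm (T x)"
      by (intro mult_left_mono S) simp
    finally show ?thesis
      by (cases "norm (T x) = 0") (auto simp: power2_eq_square)
  qed
  moreover have "bounded_clinear T"
  proof (rule bounded_clinearI[where K = 1])
    fix x y and a
    have "cinner z (T (x + y)) = cinner z (T x + T y)" for z
      by (metis (no_types) adj cinner_add_left cinner_commute)
    then show "T (x + y) = T x + T y" by (rule cinner_eqI)
    have "cinner (T (a *\<^sub>C x)) z = cinner (a *\<^sub>C T x) z" for z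
      by (simp add: adj cinner_scaleC_left)
    then show "T (a *\<^sub>C x) = a *\<^sub>C T x"
      by (metis cinner_commute cinner_eqI)
  qed (simp add: le)
  ultimately show ?thesis by (simp add: contraction_def)
qed

lemma contraction_cadjoint:
  fixes T :: "'a::complex_hilbert \<Rightarrow> 'b::complex_hilbert"
  assumes "contraction T"
  shows "contraction (cadjoint T)"
  using assms by (intro contraction_if_adjoint[of _ T] cinner_cadjoint') (auto simp: contraction_def)

section \<open>Positive square roots and defect operators\<close>

text \<open>Polarisation: the form of \<open>P\<close> is real at \<open>x + y\<close> and at \<open>\<i>x + y\<close>.\<close>

lemma positive_op_symmetric:
  assumes "positive_op P"
  shows "cinner (P x) y = cinner x (P y)"
proof -
  have lin: "bounded_clinear P" and im: "\<And>x. Im (cinner (P x) x) = 0"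
    using assms by (auto simp: positive_op_def)
  have 1: "Im (cinner (P x) y + cinner (P y) x) = 0" for x y
    using im[of "x + y"] im[of x] im[of y]
    by (simp add: bounded_clinear_simps[OF lin] cinner_add_left cinner_add_right)
  have "Re (cinner (P x) y) = Re (cinner (P y) x)"
    using 1[of "\<i> *\<^sub>C x" y]
    by (simp add: bounded_clinear_simps[OF lin] cinner_scaleC_left cinner_scaleC_right)
  then have "cinner (P x) y = cnj (cinner (P y) x)"
    using 1[of x y] by (simp add: complex_eq_iff)
  then show ?thesis
    by (metis cinner_commute)
qed

lemma positive_op_null:
  assumes "positive_op P" and null: "cinner (P y) y = 0"
  shows "P y = 0"
proof (rule ccontr)
  assume "P y \<noteq> 0"
  have lin: "bounded_clinear P" and pos: "\<And>x. 0 \<le> inner (P x) x"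
    using assms by (auto simp: positive_op_def Re_cinner)
  have sym: "inner (P x) z = inner x (P z)" for x z
    using positive_op_symmetric[OF assms(1)] by (metis Re_cinner)
  obtain K where K: "K > 0" "\<And>x. norm (P x) \<le> norm x * K"
    using bounded_linear.pos_bounded[OF bounded_clinear_bounded_linear[OF lin]] by blast
  define t where "t = 1 / K"
  have t: "t > 0" using K by (simp add: t_def)
  \<comment> \<open>Positivity at \<open>y - t P y\<close>, with \<open>t\<close> small compared to the norm of \<open>P\<close>.\<close>
  have "inner (P y) y = 0"
    using null by (metis Re_cinner zero_complex.sel(1))
  moreover have "inner (P (P y)) y = inner (P y) (P y)"
    by (rule sym)
  ultimately have "inner (P (y - t *\<^sub>R P y)) (y - t *\<^sub>R P y) =
      t\<^sup>2 * inner (P (P y)) (P y) - 2 * t * (norm (P y))\<^sup>2"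
    by (simp add: bounded_clinear_simps[OF lin] inner_diff_left inner_diff_right
        power2_norm_eq_inner) (simp add: power2_eq_square algebra_simps)
  also have "inner (P (P y)) (P y) \<le> K * (norm (P y))\<^sup>2"
  proof -
    have "inner (P (P y)) (P y) \<le> norm (P (P y)) * norm (P y)"
      by (rule norm_cauchy_schwarz)
    also have "\<dots> \<le> (norm (P y) * K) * norm (P y)"
      by (intro mult_right_mono K) simp
    finally show ?thesis by (simp add: power2_eq_square ac_simps)
  qed
  then have "t\<^sup>2 * inner (P (P y)) (P y) - 2 * t * (norm (P y))\<^sup>2
      \<le> t\<^sup>2 * (K * (norm (P y))\<^sup>2) - 2 * t * (norm (P y))\<^sup>2"
    by (intro diff_right_mono mult_left_mono) simp_all
  also have "\<dots> = - t * (norm (P y))\<^sup>2"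
    using K by (simp add: t_def power2_eq_square field_simps)
  also have "\<dots> < 0"
    using t \<open>P y \<noteq> 0\<close> by simp
  finally show False
    using pos[of "y - t *\<^sub>R P y"] by simp
qed

text \<open>
  If \<open>Y\<close> is a fixed point of \<open>Y \<mapsto> (B + Y\<^sup>2) / 2\<close>, then \<open>(I - Y)\<^sup>2 = I - B\<close>.  The iterates are
  polynomials in \<open>B\<close> whose coefficients are nonnegative and increase from one iterate to the next,
  so for a contraction \<open>B\<close> both the iterates and their differences are bounded by the values at
  \<open>B = 1\<close>.  These values form the bounded increasing sequence \<open>sqrt_iter_bound\<close>, which makes the
  iterates a Cauchy sequence in operator norm.
\<close>

fun sqrt_iter :: "('a::complex_hilbert \<Rightarrow> 'a) \<Rightarrow> nat \<Rightarrow> 'a \<Rightarrow> 'a" where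
  "sqrt_iter B 0 x = 0"
| "sqrt_iter B (Suc n) x = (1/2) *\<^sub>R (B x + sqrt_iter B n (sqrt_iter B n x))"

fun sqrt_iter_bound :: "nat \<Rightarrow> real" where
  "sqrt_iter_bound 0 = 0"
| "sqrt_iter_bound (Suc n) = (1 + (sqrt_iter_bound n)\<^sup>2) / 2"

text \<open>For a self-adjoint contraction \<open>B\<close> this is \<open>(I - B)^(1/2)\<close>.\<close>

definition sqrt_complement :: "('a::complex_hilbert \<Rightarrow> 'a) \<Rightarrow> 'a \<Rightarrow> 'a" where
  "sqrt_complement B x = x - lim (\<lambda>n. sqrt_iter B n x)"

lemma sqrt_iter_bound_range: "0 \<le> sqrt_iter_bound n \<and> sqrt_iter_bound n \<le> 1"
proof (induction n)
  case (Suc n)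
  then have "(sqrt_iter_bound n)\<^sup>2 \<le> 1" by (simp add: power_le_one)
  then show ?case by simp
qed simp

lemma sqrt_iter_bound_incseq: "incseq sqrt_iter_bound"
proof (rule incseq_SucI)
  fix n
  have "sqrt_iter_bound (Suc n) - sqrt_iter_bound n = (1 - sqrt_iter_bound n)\<^sup>2 / 2"
    by (simp add: power2_eq_square field_simps)
  also have "\<dots> \<ge> 0" by simp
  finally show "sqrt_iter_bound n \<le> sqrt_iter_bound (Suc n)" by linarith
qed

lemma sqrt_iter_bound_Cauchy: "Cauchy sqrt_iter_bound"
  using incseq_convergent[OF sqrt_iter_bound_incseq, of 1] sqrt_iter_bound_range
  by (metis LIMSEQ_imp_Cauchy)

text \<open>
  The relation \<open>B A = A C\<close> passes to polynomials in \<open>B\<close> and \<open>C\<close>, hence to square roots.  It is used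
  twice: with \<open>A\<close> a positive root of \<open>I - B\<close>, to see that any two roots commute, and with
  \<open>B = A A*\<close>, \<open>C = A* A\<close>, to intertwine the two defect operators of \<open>A\<close>.
\<close>

lemma sqrt_iter_intertwines:
  assumes "bounded_clinear A" "\<And>x. B (A x) = A (C x)"
  shows "sqrt_iter B n (A x) = A (sqrt_iter C n x)"
  by (induction n arbitrary: x) (simp_all add: bounded_clinear_simps[OF assms(1)] assms(2))

locale symmetric_contraction =
  fixes B :: "'a::complex_hilbert \<Rightarrow> 'a"
  assumes sym: "cinner (B x) y = cinner x (B y)" and contr: "contraction B"
begin

lemma lin: "bounded_clinear B" and norm_le: "norm (B x) \<le> norm x"
  using contr by (auto simp: contraction_def)

lemma sqrt_iter_add_scale:
  "sqrt_iter B n (x + y) = sqrt_iter B n x + sqrt_iter B n y"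
  "sqrt_iter B n (a *\<^sub>C x) = a *\<^sub>C sqrt_iter B n x"
  by (induction n arbitrary: x y)
    (simp_all add: bounded_clinear_simps[OF lin] algebra_simps scaleR_scaleC scaleC_add_right)

lemma norm_sqrt_iter: "norm (sqrt_iter B n x) \<le> sqrt_iter_bound n * norm x"
proof (induction n arbitrary: x)
  case (Suc n)
  have "norm (sqrt_iter B n (sqrt_iter B n x)) \<le> sqrt_iter_bound n * (sqrt_iter_bound n * norm x)"
    using Suc[of "sqrt_iter B n x"] Suc[of x] sqrt_iter_bound_range[of n]
    by (meson mult_left_mono order_trans)
  then have "norm (B x + sqrt_iter B n (sqrt_iter B n x)) \<le> norm x + (sqrt_iter_bound n)\<^sup>2 * norm x"
    using norm_le[of x] by (intro norm_triangle_le) (simp add: power2_eq_square)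
  then show ?case
    unfolding sqrt_iter.simps sqrt_iter_bound.simps norm_scaleR by (simp add: field_simps)
qed simp

lemma norm_sqrt_iter_le: "norm (sqrt_iter B n x) \<le> norm x"
  using norm_sqrt_iter[of n x] sqrt_iter_bound_range[of n]
  by (meson mult_left_le_one_le norm_ge_zero order_trans)

lemma sqrt_iter_lin: "bounded_clinear (sqrt_iter B n)"
  by (intro bounded_clinearI[where K = 1]) (simp_all add: sqrt_iter_add_scale norm_sqrt_iter_le)

lemma sqrt_iter_sym: "cinner (sqrt_iter B n x) y = cinner x (sqrt_iter B n y)"
  by (induction n arbitrary: x y)
    (simp_all add: scaleR_scaleC cinner_scaleC_left cinner_scaleC_right cinner_add_left cinner_add_right sym)

text \<open>
  By \<open>Y'\<^sup>2 - Y\<^sup>2 = Y'(Y' - Y) + (Y' - Y)Y\<close> for consecutive iterates \<open>Y\<close>, \<open>Y'\<close>; the same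
  factorisation of the scalar sequence gives exactly the matching bound.
\<close>

lemma norm_sqrt_iter_Suc_diff:
  "norm (sqrt_iter B (Suc n) x - sqrt_iter B n x)
     \<le> (sqrt_iter_bound (Suc n) - sqrt_iter_bound n) * norm x"
proof (induction n arbitrary: x)
  case 0
  then show ?case using norm_le[of x] by simp
next
  case (Suc n)
  let ?Y = "sqrt_iter B" and ?y = sqrt_iter_bound
  let ?e = "?y (Suc n) - ?y n"
  have e0: "?e \<ge> 0"
    using sqrt_iter_bound_incseq by (simp add: incseq_SucD del: sqrt_iter_bound.simps)
  have "norm (?Y (Suc n) (?Y (Suc n) x - ?Y n x)) \<le> ?y (Suc n) * norm (?Y (Suc n) x - ?Y n x)"
    by (rule norm_sqrt_iter)
  also have "\<dots> \<le> ?y (Suc n) * (?e * norm x)"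
    using Suc sqrt_iter_bound_range by (intro mult_left_mono) blast+
  finally have 1: "norm (?Y (Suc n) (?Y (Suc n) x - ?Y n x)) \<le> ?y (Suc n) * (?e * norm x)" .
  have "norm (?Y (Suc n) (?Y n x) - ?Y n (?Y n x)) \<le> ?e * norm (?Y n x)"
    by (rule Suc)
  also have "\<dots> \<le> ?e * (?y n * norm x)"
    using e0 by (intro mult_left_mono norm_sqrt_iter)
  finally have 2: "norm (?Y (Suc n) (?Y n x) - ?Y n (?Y n x)) \<le> ?e * (?y n * norm x)" .
  have "?Y (Suc (Suc n)) x - ?Y (Suc n) x =
      (1/2) *\<^sub>R (?Y (Suc n) (?Y (Suc n) x) - ?Y n (?Y n x))"
    unfolding sqrt_iter.simps(2)[of B "Suc n" x] sqrt_iter.simps(2)[of B n x]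
    by (simp add: scaleR_right_diff_distrib scaleR_right_distrib del: sqrt_iter.simps)
  also have "\<dots> = (1/2) *\<^sub>R (?Y (Suc n) (?Y (Suc n) x - ?Y n x) + (?Y (Suc n) (?Y n x) - ?Y n (?Y n x)))"
    by (simp only: bounded_clinear_simps[OF sqrt_iter_lin]) simp
  finally have "norm (?Y (Suc (Suc n)) x - ?Y (Suc n) x)
      = norm (?Y (Suc n) (?Y (Suc n) x - ?Y n x) + (?Y (Suc n) (?Y n x) - ?Y n (?Y n x))) / 2"
    by (simp del: sqrt_iter.simps)
  also have "\<dots> \<le> (?y (Suc n) * (?e * norm x) + ?e * (?y n * norm x)) / 2"
    by (intro divide_right_mono norm_triangle_le add_mono 1 2) simp
  also have "\<dots> = (?y (Suc (Suc n)) - ?y (Suc n)) * norm x"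
    by (simp add: sqrt_iter_bound.simps(2)[of "Suc n"])
       (simp add: power2_eq_square field_simps del: sqrt_iter_bound.simps)
  finally show ?case .
qed

lemma norm_sqrt_iter_diff:
  "norm (sqrt_iter B (n + k) x - sqrt_iter B n x)
     \<le> (sqrt_iter_bound (n + k) - sqrt_iter_bound n) * norm x"
proof (induction k)
  case (Suc k)
  have "norm (sqrt_iter B (n + Suc k) x - sqrt_iter B n x) \<le>
     norm (sqrt_iter B (Suc (n + k)) x - sqrt_iter B (n + k) x) + norm (sqrt_iter B (n + k) x - sqrt_iter B n x)"
    using norm_triangle_ineq[of "sqrt_iter B (Suc (n + k)) x - sqrt_iter B (n + k) x" "sqrt_iter B (n + k) x - sqrt_iter B n x"]
    by (simp del: sqrt_iter.simps)
  also have "\<dots> \<le> (sqrt_iter_bound (Suc (n + k)) - sqrt_iter_bound (n + k)) * norm x +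
      (sqrt_iter_bound (n + k) - sqrt_iter_bound n) * norm x"
    by (intro add_mono norm_sqrt_iter_Suc_diff Suc)
  also have "\<dots> = (sqrt_iter_bound (n + Suc k) - sqrt_iter_bound n) * norm x"
    by (simp add: algebra_simps del: sqrt_iter_bound.simps)
  finally show ?case .
qed simp

lemma sqrt_iter_tendsto: "(\<lambda>n. sqrt_iter B n x) \<longlonglongrightarrow> x - sqrt_complement B x"
proof -
  have "Cauchy (\<lambda>n. sqrt_iter B n x)"
  proof (rule CauchyI')
    fix e :: real assume e: "e > 0"
    have "e / (norm x + 1) > 0"
      using e by (simp add: add_nonneg_pos)
    then obtain N where N: "\<And>i j. i \<ge> N \<Longrightarrow> j \<ge> N \<Longrightarrow> norm (sqrt_iter_bound i - sqrt_iter_bound j) < e / (norm x + 1)"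
      using CauchyD[OF sqrt_iter_bound_Cauchy] by blast
    have "norm (sqrt_iter B i x - sqrt_iter B j x) < e" if ij: "N \<le> i" "i < j" for i j
    proof -
      have "norm (sqrt_iter B j x - sqrt_iter B i x) \<le> (sqrt_iter_bound j - sqrt_iter_bound i) * norm x"
        using norm_sqrt_iter_diff[of i "j - i" x] ij by simp
      also have "\<dots> \<le> (e / (norm x + 1)) * norm x"
        using N[of j i] ij by (intro mult_right_mono) auto
      also have "\<dots> < e"
        using e by (simp add: pos_divide_less_eq add_nonneg_pos)
      finally show ?thesis by (simp add: norm_minus_commute)
    qed
    then show "\<exists>M. \<forall>m\<ge>M. \<forall>n>m. dist (sqrt_iter B m x) (sqrt_iter B n x) < e"
      by (auto simp: dist_norm)
  qed
  then show ?thesis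
    by (simp add: sqrt_complement_def Cauchy_convergent_iff convergent_LIMSEQ_iff)
qed

lemma sqrt_complement_square: "sqrt_complement B (sqrt_complement B x) = x - B x"
proof -
  define Y where "Y x = x - sqrt_complement B x" for x
  have lim: "(\<lambda>n. sqrt_iter B n x) \<longlonglongrightarrow> Y x" for x
    using sqrt_iter_tendsto by (simp add: Y_def)
  have Y_diff: "Y (x - y) = Y x - Y y" for x y
    by (rule LIMSEQ_unique[OF lim[of "x - y", unfolded bounded_clinear_simps[OF sqrt_iter_lin]]
          tendsto_diff[OF lim lim]])
  have "(\<lambda>n. sqrt_iter B n (sqrt_iter B n x - Y x)) \<longlonglongrightarrow> 0"
  proof (rule Lim_null_comparison)
    show "(\<lambda>n. norm (sqrt_iter B n x - Y x)) \<longlonglongrightarrow> 0"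
      by (intro tendsto_norm_zero) (simp add: LIM_zero lim)
  qed (simp add: norm_sqrt_iter_le)
  from tendsto_add[OF this lim[of "Y x"]]
  have "(\<lambda>n. sqrt_iter B n (sqrt_iter B n x)) \<longlonglongrightarrow> Y (Y x)"
    by (simp add: bounded_clinear_simps[OF sqrt_iter_lin])
  then have "(\<lambda>n. sqrt_iter B (Suc n) x) \<longlonglongrightarrow> (1/2) *\<^sub>R (B x + Y (Y x))"
    unfolding sqrt_iter.simps by (intro tendsto_intros)
  then have "Y x = (1/2) *\<^sub>R (B x + Y (Y x))"
    using lim[of x] LIMSEQ_Suc LIMSEQ_unique by blast
  then have "2 *\<^sub>R Y x = B x + Y (Y x)"
    by (metis (no_types) scaleR_half_double scaleR_left_distrib scaleR_2 scaleR_right_distrib one_add_one)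
  moreover have "sqrt_complement B x = x - Y x" for x
    by (simp add: Y_def)
  ultimately show ?thesis
    by (simp only: Y_diff) (simp add: scaleR_2 algebra_simps)
qed

text \<open>The limit \<open>Y\<close> of the iterates is a self-adjoint contraction, so \<open>I - Y \<ge> 0\<close>.\<close>

lemma positive_sqrt_complement: "positive_op (sqrt_complement B)"
proof -
  define Y where "Y x = x - sqrt_complement B x" for x
  have lim: "(\<lambda>n. sqrt_iter B n x) \<longlonglongrightarrow> Y x" for x
    using sqrt_iter_tendsto by (simp add: Y_def)
  have norm_Y: "norm (Y x) \<le> norm x" for x
    using tendsto_norm[OF lim[of x]] norm_sqrt_iter_le by (intro LIMSEQ_le_const2) auto
  have "Y (x + y) = Y x + Y y" for x y
    by (rule LIMSEQ_unique[OF lim[of "x + y", unfolded sqrt_iter_add_scale] tendsto_add[OF lim lim]])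
  moreover have "Y (a *\<^sub>C x) = a *\<^sub>C Y x" for a x
  proof -
    have "(\<lambda>n. a *\<^sub>C sqrt_iter B n x) \<longlonglongrightarrow> a *\<^sub>C Y x"
      by (rule bounded_linear.tendsto[OF bounded_clinear_bounded_linear[OF bounded_clinear_scaleC] lim])
    from LIMSEQ_unique[OF lim[of "a *\<^sub>C x", unfolded sqrt_iter_add_scale] this] show ?thesis .
  qed
  ultimately have "bounded_clinear Y"
    using norm_Y by (intro bounded_clinearI[where K = 1]) simp_all
  then have "bounded_clinear (\<lambda>x. x - Y x)"
    by (intro bounded_clinear_diff bounded_clinear_ident)
  moreover have S: "(\<lambda>x. x - Y x) = sqrt_complement B"
    by (auto simp: Y_def)
  ultimately have "bounded_clinear (sqrt_complement B)"
    by simp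
  moreover have "Im (cinner (sqrt_complement B x) x) = 0" for x
  proof -
    have "Im (cinner (sqrt_iter B n x) x) = 0" for n
      using arg_cong[OF cinner_commute[of x "sqrt_iter B n x"], of Im] by (simp add: sqrt_iter_sym)
    then have 1: "inner (sqrt_iter B n x) (\<i> *\<^sub>C x) = 0" for n
      unfolding Re_cinner[symmetric] cinner_scaleC_right by simp
    have "(\<lambda>n. inner (sqrt_iter B n x) (\<i> *\<^sub>C x)) \<longlonglongrightarrow> inner (Y x) (\<i> *\<^sub>C x)"
      by (intro tendsto_inner lim tendsto_const)
    then have "inner (Y x) (\<i> *\<^sub>C x) = 0"
      unfolding 1 by (simp add: LIMSEQ_const_iff)
    then have "Im (cinner (Y x) x) = 0"
      unfolding Re_cinner[symmetric] cinner_scaleC_right by simp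
    then show ?thesis
      unfolding S[symmetric] by (simp add: cinner_diff_left cinner_self)
  qed
  moreover have "0 \<le> Re (cinner (sqrt_complement B x) x)" for x
  proof -
    have "inner (Y x) x \<le> norm (Y x) * norm x"
      by (rule norm_cauchy_schwarz)
    also have "\<dots> \<le> norm x * norm x"
      by (intro mult_right_mono norm_Y) simp
    finally show ?thesis
      unfolding S[symmetric] Re_cinner
      by (simp add: inner_diff_left power2_norm_eq_inner[symmetric] power2_eq_square)
  qed
  ultimately show ?thesis
    by (simp add: positive_op_def)
qed

text \<open>
  A root \<open>R\<close> commutes with \<open>B = I - R\<^sup>2\<close> and therefore with the constructed root \<open>S\<close>.  For
  \<open>y = (R - S) x\<close> this gives \<open>(R + S) y = (R\<^sup>2 - S\<^sup>2) x = 0\<close>; positivity forces \<open>R y = S y = 0\<close>, and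
  then \<open>\<parallel>y\<parallel>\<^sup>2 = \<langle>x, (R - S) y\<rangle> = 0\<close>.
\<close>

lemma sqrt_complement_unique:
  assumes R: "positive_op R" and sq: "\<And>x. R (R x) = x - B x"
  shows "R = sqrt_complement B"
proof
  fix x
  let ?S = "sqrt_complement B"
  have linR: "bounded_clinear R" and linS: "bounded_clinear ?S"
    using R positive_sqrt_complement by (auto simp: positive_op_def)
  have B_eq: "B x = x - R (R x)" for x
    using sq by simp
  have commute: "?S (R x) = R (?S x)" for x
  proof -
    have "B (R x) = R (B x)" for x
      by (simp add: B_eq bounded_clinear_simps[OF linR])
    then have "(\<lambda>n. R (sqrt_iter B n x)) \<longlonglongrightarrow> R x - ?S (R x)"
      using sqrt_iter_tendsto[of "R x"] by (simp add: sqrt_iter_intertwines[OF linR])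
    moreover have "(\<lambda>n. R (sqrt_iter B n x)) \<longlonglongrightarrow> R (x - ?S x)"
      using sqrt_iter_tendsto bounded_linear.tendsto[OF bounded_clinear_bounded_linear[OF linR]] by blast
    ultimately show ?thesis
      using LIMSEQ_unique by (fastforce simp: bounded_clinear_simps[OF linR])
  qed
  define y where "y = R x - ?S x"
  have "R y + ?S y = 0"
    by (simp add: y_def bounded_clinear_simps[OF linR] bounded_clinear_simps[OF linS] commute sq sqrt_complement_square)
  then have sum0: "cinner (R y) y + cinner (?S y) y = 0"
    by (metis cinner_add_left cinner_zero(1))
  have "cinner (R y) y = 0 \<and> cinner (?S y) y = 0"
    using R positive_sqrt_complement sum0
    unfolding positive_op_def complex_eq_iff by (simp add: add_nonneg_eq_0_iff)
  then have "R y = 0" "?S y = 0"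
    using positive_op_null R positive_sqrt_complement by blast+
  moreover have "cinner y y = cinner x (R y - ?S y)"
    by (subst (1) y_def)
      (simp add: cinner_diff_left cinner_diff_right positive_op_symmetric[OF R] positive_op_symmetric[OF positive_sqrt_complement])
  ultimately have "cinner y y = 0" by simp
  then show "R x = ?S x"
    by (simp add: cinner_self y_def)
qed

lemma op_sqrt_eq_sqrt_complement: "op_sqrt (\<lambda>x. x - B x) = sqrt_complement B"
  unfolding op_sqrt_def
proof (rule the_equality)
  show "positive_op (sqrt_complement B) \<and> (\<forall>x. sqrt_complement B (sqrt_complement B x) = x - B x)"
    using positive_sqrt_complement sqrt_complement_square by blast
  show "R = sqrt_complement B" if "positive_op R \<and> (\<forall>x. R (R x) = x - B x)" for R
    using that sqrt_complement_unique by blast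
qed

end

lemma symmetric_contraction_adjoint_comp:
  fixes T :: "'a::complex_hilbert \<Rightarrow> 'b::complex_hilbert"
  assumes "contraction T"
  shows "symmetric_contraction (\<lambda>x. cadjoint T (T x))"
proof
  have lin: "bounded_clinear T" using assms by (simp add: contraction_def)
  show "cinner (cadjoint T (T x)) y = cinner x (cadjoint T (T y))" for x y
    unfolding cinner_cadjoint'[OF lin] by (rule cinner_cadjoint[OF lin])
  show "contraction (\<lambda>x. cadjoint T (T x))"
    unfolding contraction_def
  proof (rule conjI)
    show "bounded_clinear (\<lambda>x. cadjoint T (T x))"
      using contraction_cadjoint[OF assms] lin
      by (intro bounded_clinear_compose[of "cadjoint T" T]) (auto simp: contraction_def)
    show "\<forall>x. norm (cadjoint T (T x)) \<le> norm x"
    proof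
      fix x
      have "norm (cadjoint T (T x)) \<le> norm (T x)"
        using contraction_cadjoint[OF assms] by (simp add: contraction_def)
      also have "\<dots> \<le> norm x"
        using assms by (simp add: contraction_def)
      finally show "norm (cadjoint T (T x)) \<le> norm x" .
    qed
  qed
qed

context
  fixes T :: "'a::complex_hilbert \<Rightarrow> 'b::complex_hilbert"
  assumes T: "contraction T"
begin

interpretation symmetric_contraction "\<lambda>x. cadjoint T (T x)"
  using T by (rule symmetric_contraction_adjoint_comp)

lemma defect_op_eq_sqrt_complement: "defect_op T = sqrt_complement (\<lambda>x. cadjoint T (T x))"
  unfolding defect_op_def by (rule op_sqrt_eq_sqrt_complement)

lemma positive_defect_op: "positive_op (defect_op T)"
  unfolding defect_op_eq_sqrt_complement by (rule positive_sqrt_complement)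

lemma defect_op_lin: "bounded_clinear (defect_op T)"
  using positive_defect_op by (simp add: positive_op_def)

lemma defect_op_sym: "cinner (defect_op T x) y = cinner x (defect_op T y)"
  by (rule positive_op_symmetric[OF positive_defect_op])

lemma defect_op_square: "defect_op T (defect_op T x) = x - cadjoint T (T x)"
  unfolding defect_op_eq_sqrt_complement by (rule sqrt_complement_square)

lemma norm_defect_op: "(norm (defect_op T x))\<^sup>2 = (norm x)\<^sup>2 - (norm (T x))\<^sup>2"
proof -
  have "complex_of_real ((norm (defect_op T x))\<^sup>2) = cinner x x - cinner x (cadjoint T (T x))"
    unfolding cinner_self[symmetric] defect_op_sym defect_op_square cinner_diff_right ..
  also have "\<dots> = complex_of_real ((norm x)\<^sup>2 - (norm (T x))\<^sup>2)"
    using T by (simp add: contraction_def cinner_cadjoint[symmetric] cinner_self)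
  finally show ?thesis
    unfolding of_real_eq_iff .
qed

text \<open>For a partial isometry \<open>T\<close> the operator \<open>I - T*T\<close> is a projection, hence its own square root.\<close>

lemma defect_op_projection:
  assumes "\<And>x. T (cadjoint T (T x)) = T x"
  shows "defect_op T = (\<lambda>x. x - cadjoint T (T x))"
proof -
  let ?P = "\<lambda>x. x - cadjoint T (T x)"
  have lin: "bounded_clinear T" "bounded_clinear (cadjoint T)"
    using T contraction_cadjoint[OF T] by (simp_all add: contraction_def)
  have idem: "?P (?P x) = ?P x" for x
    by (simp add: bounded_clinear_simps[OF lin(1)] bounded_clinear_simps[OF lin(2)] assms)
  have "cinner (?P x) x = complex_of_real ((norm x)\<^sup>2 - (norm (T x))\<^sup>2)" for x
    by (simp add: cinner_diff_left cinner_cadjoint'[OF lin(1)] cinner_self)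
  moreover have "(norm (T x))\<^sup>2 \<le> (norm x)\<^sup>2" for x
    using T by (simp add: contraction_def power_mono)
  ultimately have "positive_op ?P"
    using bounded_clinear_diff[OF bounded_clinear_ident bounded_clinear_compose[OF lin(2,1)]]
    by (auto simp: positive_op_def)
  then show ?thesis
    unfolding defect_op_eq_sqrt_complement using idem by (intro sqrt_complement_unique[symmetric]) auto
qed

end

lemma defect_op_intertwines:
  fixes T :: "'a::complex_hilbert \<Rightarrow> 'b::complex_hilbert"
  assumes T: "contraction T"
  shows "T (defect_op T x) = defect_op (cadjoint T) (T x)"
proof -
  have lin: "bounded_clinear T" using T by (simp add: contraction_def)
  note T' = contraction_cadjoint[OF T]
  interpret B: symmetric_contraction "\<lambda>x. cadjoint T (T x)"
    using T by (rule symmetric_contraction_adjoint_comp)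
  interpret C: symmetric_contraction "\<lambda>x. cadjoint (cadjoint T) (cadjoint T x)"
    using T' by (rule symmetric_contraction_adjoint_comp)
  have "(\<lambda>n. T (sqrt_iter (\<lambda>x. cadjoint T (T x)) n x)) \<longlonglongrightarrow> T x - defect_op (cadjoint T) (T x)"
    using C.sqrt_iter_tendsto[of "T x"]
    by (simp add: sqrt_iter_intertwines[OF lin, of _ "\<lambda>x. cadjoint T (T x)"] defect_op_eq_sqrt_complement[OF T'] cadjoint_cadjoint[OF lin])
  moreover have "(\<lambda>n. T (sqrt_iter (\<lambda>x. cadjoint T (T x)) n x)) \<longlonglongrightarrow> T (x - defect_op T x)"
    unfolding defect_op_eq_sqrt_complement[OF T]
    using B.sqrt_iter_tendsto bounded_linear.tendsto[OF bounded_clinear_bounded_linear[OF lin]] by blast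
  ultimately show ?thesis
    using LIMSEQ_unique by (fastforce simp: bounded_clinear_simps[OF lin])
qed

section \<open>The bilateral sum\<close>

lemma fst_coord [simp]: "0 \<le> n \<Longrightarrow> fst (coord h n) = 0"
  and snd_coord [simp]: "n < 0 \<Longrightarrow> snd (coord h n) = 0"
  using coord[of h] by auto

text \<open>As rewrite rules these equations loop; they serve to split off a coordinate.\<close>

lemma coord_nonneg: "0 \<le> n \<Longrightarrow> coord h n = (0, snd (coord h n))"
  and coord_neg: "n < 0 \<Longrightarrow> coord h n = (fst (coord h n), 0)"
  by (simp_all add: prod_eq_iff)

lemma zero_pair [simp]: "(0, 0) = 0"
  by (simp add: zero_prod_def)

lemma cinner_Pair [simp]: "cinner (a, b) (c, d) = cinner a c + cinner b d"
  by (simp add: cinner_prod_def)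

lemma scaleC_Pair [simp]: "a *\<^sub>C (x, y) = (a *\<^sub>C x, a *\<^sub>C y)"
  and fst_scaleC [simp]: "fst (a *\<^sub>C p) = a *\<^sub>C fst p"
  and snd_scaleC [simp]: "snd (a *\<^sub>C p) = a *\<^sub>C snd p"
  by (simp_all add: scaleC_prod_def)

lift_definition coord_proj ::
    "int set \<Rightarrow> ('m::complex_inner, 'n::complex_inner) bilateral_sum \<Rightarrow> ('m, 'n) bilateral_sum"
  is "\<lambda>I h n. if n \<in> I then h n else 0"
  by (auto elim!: summable_on_comparison_test)

lemma coord_coord_proj [simp]: "coord (coord_proj I h) n = (if n \<in> I then coord h n else 0)"
  by (simp add: coord_proj.rep_eq)

lemma coord_incl_nonneg [simp]: "coord (incl_nonneg n x) k = (if k = int n then (0, x) else 0)"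
  by (simp add: incl_nonneg.rep_eq)

lemma coord_incl_neg [simp]: "coord (incl_neg n x) k = (if k = n \<and> n < 0 then (x, 0) else 0)"
  by (simp add: incl_neg.rep_eq)

lemma mem_summands: "h \<in> summands I \<longleftrightarrow> (\<forall>n. n \<notin> I \<longrightarrow> coord h n = 0)"
  by (simp add: summands_def)

lemma coord_proj_in_summands: "coord_proj I h \<in> summands I"
  by (simp add: mem_summands)

lemma closed_summands: "closed_csubspace (summands I)"
proof -
  have "bounded_linear (\<lambda>h. coord h n)" for n
    by (rule bounded_linear_intro[where K = 1]) (simp_all add: norm_coord_le)
  then have "closed {h. coord h n = 0}" for n
    by (intro closed_Collect_eq continuous_intros linear_continuous_on)
  then have "closed (\<Inter>n\<in>-I. {h. coord h n = 0})"
    by blast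
  moreover have "(\<Inter>n\<in>-I. {h. coord h n = 0}) = summands I"
    by (auto simp: summands_def)
  ultimately have "closed (summands I)"
    by metis
  then show ?thesis
    by (simp add: closed_csubspace_def complex_vector.subspace_def mem_summands)
qed

lemma cinner_supported:
  assumes "finite F" "\<And>n. n \<notin> F \<Longrightarrow> cinner (coord h n) (coord g n) = 0"
  shows "cinner h g = (\<Sum>n\<in>F. cinner (coord h n) (coord g n))"
proof -
  have "cinner h g = (\<Sum>\<^sub>\<infinity>n\<in>F. cinner (coord h n) (coord g n))"
    unfolding cinner_bilateral_sum_def using assms(2) by (intro infsum_cong_neutral) auto
  then show ?thesis
    using assms(1) by simp
qed

lemma norm_supported:
  assumes "finite F" "\<And>n. n \<notin> F \<Longrightarrow> coord h n = 0"
  shows "(norm h)\<^sup>2 = (\<Sum>n\<in>F. (norm (coord h n))\<^sup>2)"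
proof -
  have "(norm h)\<^sup>2 = (\<Sum>\<^sub>\<infinity>n\<in>F. (norm (coord h n))\<^sup>2)"
    unfolding norm_bilateral_sum using assms(2) by (intro infsum_cong_neutral) auto
  then show ?thesis
    using assms(1) by simp
qed

lemma cinner_coord_proj_single: "cinner h (coord_proj {n} g) = cinner (coord h n) (coord g n)"
  by (subst cinner_supported[of "{n}"]) auto

lemma cinner_incl_nonneg: "cinner h (incl_nonneg n x) = cinner (snd (coord h (int n))) x"
  by (subst cinner_supported[of "{int n}"]) (auto simp: cinner_prod_def)

lemma summands_orthogonal:
  assumes "I \<inter> J = {}"
  shows "summands I \<subseteq> orth_complement (summands J)"
proof
  fix h :: "('a, 'b) bilateral_sum" assume h: "h \<in> summands I"
  have "cinner h g = 0" if "g \<in> summands J" for g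
  proof -
    have "coord h n = 0 \<or> coord g n = 0" for n
      using h that assms by (auto simp: mem_summands)
    then have "cinner (coord h n) (coord g n) = 0" for n
      by (metis cinner_zero)
    then show ?thesis
      by (subst cinner_supported[of "{}"]) auto
  qed
  then show "h \<in> orth_complement (summands J)"
    by (simp add: orth_complement_def)
qed

lemma sq_summable_shift_left:
  fixes f g :: "int \<Rightarrow> 'a::real_normed_vector"
  assumes f: "(\<lambda>n. (norm (f n))\<^sup>2) summable_on UNIV"
    and F: "finite F" and eq: "\<And>n. n \<notin> F \<Longrightarrow> g n = f (n + 1)"
  shows "(\<lambda>n. (norm (g n))\<^sup>2) summable_on UNIV"
proof -
  have bij: "bij_betw (uminus :: int \<Rightarrow> int) UNIV UNIV"
    by (rule bij_betw_byWitness[where f' = uminus]) auto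
  have "(\<lambda>n. (norm (f (- n)))\<^sup>2) summable_on UNIV"
    using summable_on_reindex_bij_betw[OF bij, of "\<lambda>n. (norm (f n))\<^sup>2"] f by simp
  then have "(\<lambda>n. (norm (g (- n)))\<^sup>2) summable_on UNIV"
  proof (rule sq_summable_shift[where F = "uminus ` F"])
    fix n assume "n \<notin> uminus ` F"
    then have "- n \<notin> F" by (metis imageI minus_minus)
    then show "g (- n) = f (- (n - 1))" by (simp add: eq add.commute)
  qed (use F in simp)
  then show ?thesis
    using summable_on_reindex_bij_betw[OF bij, of "\<lambda>n. (norm (g n))\<^sup>2"] by simp
qed

text \<open>
  The adjoint of \<open>T_A m A\<close> in coordinates.  The coordinate at \<open>0\<close> of the argument is lost: its target
  \<open>- 1\<close> is filled from the coordinate at \<open>m\<close>.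
\<close>

lift_definition T_A_adj ::
    "nat \<Rightarrow> ('m \<Rightarrow> 'n) \<Rightarrow>
     ('m::complex_hilbert, 'n::complex_hilbert) bilateral_sum \<Rightarrow> ('m, 'n) bilateral_sum"
  is "\<lambda>m A g k.
        if k = - 1 then (- cadjoint A (snd (g (int m))), 0)
        else if k = int m - 1 then (0, defect_op (cadjoint A) (snd (g (int m))))
        else g (k + 1)"
  subgoal for m A g
    by (auto intro!: sq_summable_shift_left[where f = g and F = "{- 1, int m - 1}"] split: if_splits)
  done

section \<open>The operator and its adjoint\<close>

locale bilateral_model =
  fixes A :: "'m::complex_hilbert \<Rightarrow> 'n::complex_hilbert" and m :: nat
  assumes m: "m \<ge> 1" and pure: "pure_contraction A"
begin

abbreviation T :: "('m, 'n) bilateral_sum \<Rightarrow> ('m, 'n) bilateral_sum" where "T \<equiv> T_A m A"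
abbreviation Ts :: "('m, 'n) bilateral_sum \<Rightarrow> ('m, 'n) bilateral_sum" where "Ts \<equiv> T_A_adj m A"
abbreviation As :: "'n \<Rightarrow> 'm" where "As \<equiv> cadjoint A"
abbreviation D :: "'n \<Rightarrow> 'n" where "D \<equiv> defect_op As"
abbreviation DA :: "'m \<Rightarrow> 'm" where "DA \<equiv> defect_op A"

lemma A_contraction: "contraction A"
  unfolding contraction_def
proof (rule conjI; (intro allI)?)
  show "bounded_clinear A"
    using pure by (simp add: pure_contraction_def)
  then show "norm (A x) \<le> norm x" for x
    using pure less_imp_le[of "norm (A x)" "norm x"]
    by (cases "x = 0") (auto simp: pure_contraction_def bounded_clinear_simps)
qed

lemma A_lin: "bounded_clinear A"
  using A_contraction by (simp add: contraction_def)

lemmas As_contraction = contraction_cadjoint[OF A_contraction]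

lemma As_lin: "bounded_clinear As"
  using As_contraction by (simp add: contraction_def)

lemmas D_lin = defect_op_lin[OF As_contraction] and DA_lin = defect_op_lin[OF A_contraction]
lemmas A_simps [simp] = bounded_clinear_simps[OF A_lin]
lemmas As_simps [simp] = bounded_clinear_simps[OF As_lin]
lemmas D_simps [simp] = bounded_clinear_simps[OF D_lin]
lemmas DA_simps [simp] = bounded_clinear_simps[OF DA_lin]

lemma D_square: "D (D y) = y - A (As y)"
  using defect_op_square[OF As_contraction] cadjoint_cadjoint[OF A_lin] by simp

lemma DA_square: "DA (DA x) = x - As (A x)"
  by (rule defect_op_square[OF A_contraction])

lemma A_DA: "A (DA x) = D (A x)"
  by (rule defect_op_intertwines[OF A_contraction])

lemma DA_As: "DA (As y) = As (D y)"
  using defect_op_intertwines[OF As_contraction] cadjoint_cadjoint[OF A_lin] by simp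

text \<open>\<open>D y = 0\<close> says \<open>A A* y = y\<close>, so that \<open>\<parallel>A* y\<parallel> \<le> \<parallel>y\<parallel> = \<parallel>A (A* y)\<parallel>\<close>, against purity at \<open>A* y\<close>.\<close>

lemma D_injective:
  assumes "D y = 0"
  shows "y = 0"
proof (rule ccontr)
  assume "y \<noteq> 0"
  have y: "A (As y) = y"
    using D_square[of y] assms by simp
  with \<open>y \<noteq> 0\<close> have "As y \<noteq> 0" by force
  then have "norm (A (As y)) < norm (As y)"
    using pure by (simp add: pure_contraction_def)
  also have "\<dots> \<le> norm y"
    using As_contraction by (simp add: contraction_def)
  finally show False using y by simp
qed

lemma coord_T: "coord (T h) k = (if k = 0 then 0
    else if k = int m then (0, D (snd (coord h (int m - 1))) - A (fst (coord h (- 1))))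
    else coord h (k - 1))"
  by (simp add: T_A.rep_eq)

lemma coord_Ts: "coord (Ts g) k = (if k = - 1 then (- As (snd (coord g (int m))), 0)
    else if k = int m - 1 then (0, D (snd (coord g (int m)))) else coord g (k + 1))"
  by (simp add: T_A_adj.rep_eq)

lemma T_adjoint: "cinner (T h) g = cinner h (Ts g)"
proof -
  define f where "f k = cinner (coord (T h) k) (coord g k)" for k
  define f' where "f' k = cinner (coord h k) (coord (Ts g) k)" for k
  have f: "f summable_on UNIV" and f': "f' summable_on UNIV"
    unfolding f_def f'_def by (intro cinner_summable coord_sq_summable)+
  have bij: "bij_betw (\<lambda>k::int. k + 1) UNIV UNIV"
    by (rule bij_betw_byWitness[where f' = "\<lambda>k. k - 1"]) auto
  have f_shift: "(\<lambda>k. f (k + 1)) summable_on UNIV"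
    using summable_on_reindex_bij_betw[OF bij, of f] f by simp
  \<comment> \<open>The shifted sum differs from the other only in the terms with \<open>k = - 1\<close> and \<open>k = m - 1\<close>,
    and these two differences cancel.\<close>
  have "infsum (\<lambda>k. f (k + 1)) UNIV + - infsum f' UNIV = (\<Sum>\<^sub>\<infinity>k. f (k + 1) + - f' k)"
    unfolding infsum_uminus[symmetric]
    by (rule infsum_add[symmetric, OF f_shift summable_on_uminus[THEN iffD2, OF f']])
  also have "\<dots> = (\<Sum>\<^sub>\<infinity>k\<in>{- 1, int m - 1}. f (k + 1) + - f' k)"
    by (intro infsum_cong_neutral) (auto simp: f_def f'_def coord_T coord_Ts)
  also have "\<dots> = (f 0 - f' (- 1)) + (f (int m) - f' (int m - 1))"
    using m by simp
  also have "\<dots> = 0"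
  proof -
    obtain x y z where "coord h (- 1) = (x, 0)" "coord h (int m - 1) = (0, y)" "coord g (int m) = (0, z)"
      using coord_neg[of "- 1" h] coord_nonneg[of "int m - 1" h] coord_nonneg[of "int m" g] m by auto
    then show ?thesis
      using m
      by (simp add: f_def f'_def coord_T coord_Ts cinner_diff_left cinner_cadjoint[OF A_lin]
          defect_op_sym[OF As_contraction])
  qed
  finally have "infsum (\<lambda>k. f (k + 1)) UNIV = infsum f' UNIV"
    by simp
  moreover have "infsum (\<lambda>k. f (k + 1)) UNIV = infsum f UNIV"
    by (rule infsum_reindex_bij_betw[OF bij])
  ultimately show ?thesis
    by (simp add: cinner_bilateral_sum_def flip: f_def f'_def)
qed

lemma T_Ts: "T (Ts g) = g - coord_proj {0} g"
proof (rule bilateral_sum_eqI)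
  fix k
  have "snd (coord g (int m)) = D (D (snd (coord g (int m)))) + A (As (snd (coord g (int m))))"
    by (simp add: D_square)
  then show "coord (T (Ts g)) k = coord (g - coord_proj {0} g) k"
    using m coord_nonneg[of "int m" g] by (auto simp: coord_T coord_Ts)
qed

lemma norm_Ts: "(norm (Ts g))\<^sup>2 = (norm g)\<^sup>2 - (norm (coord g 0))\<^sup>2"
proof -
  have "complex_of_real ((norm (Ts g))\<^sup>2) = cinner (T (Ts g)) g"
    by (simp only: T_adjoint cinner_self)
  also have "\<dots> = cinner g (g - coord_proj {0} g)"
    using T_Ts by (metis T_adjoint cinner_commute)
  also have "\<dots> = complex_of_real ((norm g)\<^sup>2 - (norm (coord g 0))\<^sup>2)"
    by (simp add: cinner_diff_right cinner_coord_proj_single cinner_self)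
  finally show ?thesis
    unfolding of_real_eq_iff .
qed

lemma T_contraction: "contraction T"
proof (rule contraction_if_adjoint[OF T_adjoint])
  fix g
  have "(norm (Ts g))\<^sup>2 \<le> (norm g)\<^sup>2"
    by (simp add: norm_Ts)
  then show "norm (Ts g) \<le> norm g"
    by (rule power2_le_imp_le) simp
qed

lemma T_lin: "bounded_clinear T"
  using T_contraction by (simp add: contraction_def)

lemma cadjoint_T: "cadjoint T = Ts"
  by (rule cadjoint_eqI) (rule T_adjoint)

lemma Ts_contraction: "contraction Ts"
  using contraction_cadjoint[OF T_contraction] by (simp add: cadjoint_T)

lemma Ts_lin: "bounded_clinear Ts"
  using Ts_contraction by (simp add: contraction_def)

lemma cadjoint_Ts: "cadjoint Ts = T"
  using cadjoint_cadjoint[OF T_lin] by (simp add: cadjoint_T)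

lemmas T_simps [simp] = bounded_clinear_simps[OF T_lin]
lemmas Ts_simps [simp] = bounded_clinear_simps[OF Ts_lin]

text \<open>The range of \<open>T\<close> is orthogonal to \<open>\<L>\<^sub>0\<close>.\<close>

lemma T_Ts_T: "T (Ts (T h)) = T h"
  by (rule bilateral_sum_eqI) (simp add: T_Ts coord_T)

lemma defect_op_T: "defect_op T = (\<lambda>h. h - Ts (T h))"
  by (rule defect_op_projection[OF T_contraction, unfolded cadjoint_T, OF T_Ts_T])

lemma defect_op_Ts: "defect_op Ts = coord_proj {0}"
proof -
  have "Ts (coord_proj {0} g) = 0" for g
    using m by (intro bilateral_sum_eqI) (simp add: coord_Ts)
  then have "Ts (T (Ts g)) = Ts g" for g
    by (simp add: T_Ts)
  then show ?thesis
    using defect_op_projection[OF Ts_contraction] by (simp add: cadjoint_Ts T_Ts)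
qed

lemma defect_space_T: "defect_space T = {h. T h = 0}"
proof -
  have "h \<in> range (\<lambda>h. h - Ts (T h))" if "T h = 0" for h
    using that by (intro image_eqI[of _ _ h]) simp_all
  then have "range (defect_op T) = {h. T h = 0}"
    by (auto simp: defect_op_T T_Ts_T)
  moreover have "closed {h. T h = 0}"
    by (intro closed_Collect_eq continuous_intros linear_continuous_on
        bounded_clinear_bounded_linear T_lin)
  ultimately show ?thesis
    by (simp add: defect_space_def)
qed

lemma defect_space_Ts: "defect_space Ts = summands {0}"
proof -
  have "h \<in> range (coord_proj {0})" if "h \<in> summands {0}" for h
    using that by (intro image_eqI[of _ _ h] bilateral_sum_eqI) (auto simp: mem_summands)
  then have "range (defect_op Ts) = summands {0}"
    by (auto simp: defect_op_Ts coord_proj_in_summands)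
  moreover have "closed (summands {0} :: ('m, 'n) bilateral_sum set)"
    by (rule closed_summands[unfolded closed_csubspace_def, THEN conjunct2])
  ultimately show ?thesis
    by (simp add: defect_space_def)
qed

lemma partial_isometry_T: "partial_isometry T"
  unfolding partial_isometry_def
proof (intro conjI ballI T_lin)
  fix x assume x: "x \<in> orth_complement {y. T y = 0}"
  have "T (x - Ts (T x)) = 0"
    by (simp add: T_Ts_T)
  with x have "cinner x (x - Ts (T x)) = 0"
    by (auto simp: orth_complement_def)
  then have "cinner x x = cinner (T x) (T x)"
    by (simp add: cinner_diff_right T_adjoint)
  then show "norm (T x) = norm x"
    by (simp add: cinner_self flip: of_real_power)
qed

text \<open>
  The backward shift brings every coordinate with nonnegative index to \<open>\<L>\<^sub>0\<close>.  On the way the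
  injective operator \<open>D\<close> is applied between \<open>\<L>\<^sub>m\<close> and \<open>\<L>\<^bsub>m-1\<^esub>\<close>, so nothing is lost.
\<close>

lemma summands_neg_if:
  assumes "\<And>k. coord ((Ts ^^ k) h) 0 = 0"
  shows "h \<in> summands {..- 1}"
proof -
  have "\<forall>h. (\<forall>k. coord ((Ts ^^ k) h) 0 = 0) \<longrightarrow> coord h (int j) = 0" for j
  proof (induction j)
    case 0
    show ?case by (auto dest: spec[of _ 0])
  next
    case (Suc j)
    show ?case
    proof (intro allI impI)
      fix h assume h: "\<forall>k. coord ((Ts ^^ k) h) 0 = 0"
      have "coord ((Ts ^^ k) (Ts h)) 0 = 0" for k
        using h by (metis funpow_Suc_right comp_apply)
      then have 0: "coord (Ts h) (int j) = 0"
        using Suc by blast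
      show "coord h (int (Suc j)) = 0"
      proof (cases "int j = int m - 1")
        case True
        then have "D (snd (coord h (int m))) = 0"
          using 0 by (simp add: coord_Ts prod_eq_iff)
        then show ?thesis
          using True D_injective by (simp add: prod_eq_iff)
      next
        case False
        then show ?thesis
          using 0 by (simp add: coord_Ts add.commute)
      qed
    qed
  qed
  then have "coord h (int j) = 0" for j
    using assms by blast
  then have "coord h n = 0" if "n \<notin> {..- 1}" for n
    using that by (cases n rule: int_cases) auto
  then show ?thesis
    by (simp add: mem_summands)
qed

text \<open>
  On a reducing subspace \<open>S\<close> where \<open>T\<close> is unitary, \<open>S = T S\<close> has no component in \<open>\<L>\<^sub>0\<close>, and neither
  have the vectors \<open>T*\<^sup>k h\<close>.  So \<open>S\<close> lives on the negative summands, and applying \<open>T\<close> pushes each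
  of its coordinates to \<open>\<L>\<^bsub>-1\<^esub>\<close>, which \<open>S\<close> does not meet either.
\<close>

lemma completely_non_unitary_T: "completely_non_unitary T"
  unfolding completely_non_unitary_def
proof (intro conjI T_contraction notI)
  assume "\<exists>S. reducing_subspace T S \<and> S \<noteq> {0} \<and> unitary_on S S T"
  then obtain S where S: "reducing_subspace T S" "S \<noteq> {0}" "unitary_on S S T"
    by blast
  have T_S: "T h \<in> S" and Ts_S: "Ts h \<in> S" and norm_T: "norm (T h) = norm h" if "h \<in> S" for h
    using S that by (auto simp: reducing_subspace_def cadjoint_T unitary_on_def)
  have 0: "coord h 0 = 0" if "h \<in> S" for h
  proof -
    have "h \<in> T ` S"
      using S(3) that by (simp add: unitary_on_def)
    then show ?thesis
      by (auto simp: coord_T)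
  qed
  have pow: "(Ts ^^ k) h \<in> S" if "h \<in> S" for h k
    by (induction k) (simp_all add: that Ts_S)
  have neg: "h \<in> summands {..- 1}" if "h \<in> S" for h
    using 0 pow that by (intro summands_neg_if) blast
  \<comment> \<open>On \<open>S\<close> the adjoint inverts \<open>T\<close>, and the coordinate at \<open>- 1\<close> of \<open>T* (T h)\<close> depends only on the
    coordinate at \<open>m\<close> of \<open>T h\<close>, which vanishes.\<close>
  have minus1: "coord h (- 1) = 0" if "h \<in> S" for h
  proof -
    have "(norm (defect_op T h))\<^sup>2 = 0"
      using norm_defect_op[OF T_contraction, of h] norm_T[OF that] by simp
    then have "h = Ts (T h)"
      by (simp add: defect_op_T)
    moreover have "coord (T h) (int m) = 0"
      using neg[OF T_S[OF that]] by (simp add: mem_summands)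
    ultimately show ?thesis
      by (metis (no_types) As_simps(4) coord_Ts neg_0_equal_iff_equal snd_zero zero_pair)
  qed
  have "\<forall>h\<in>S. coord h (- 1 - int j) = 0" for j
  proof (induction j)
    case 0
    then show ?case using minus1 by simp
  next
    case (Suc j)
    show ?case
    proof
      fix h assume "h \<in> S"
      then have "coord (T h) (- 1 - int j) = 0"
        using Suc T_S by blast
      then show "coord h (- 1 - int (Suc j)) = 0"
        by (simp add: coord_T algebra_simps split: if_splits)
    qed
  qed
  then have "h = 0" if "h \<in> S" for h
  proof (intro bilateral_sum_eqI)
    fix n
    show "coord h n = coord 0 n"
    proof (cases "n < 0")
      case True
      then have "n = - 1 - int (nat (- 1 - n))" by simp
      then show ?thesis
        using \<open>\<And>j. \<forall>h\<in>S. coord h (- 1 - int j) = 0\<close> that by (metis coord_simps(1))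
    qed (use neg[OF that] in \<open>simp add: mem_summands\<close>)
  qed
  moreover have "0 \<in> S"
    using S(1) by (simp add: reducing_subspace_def closed_csubspace_def complex_vector.subspace_0)
  ultimately show False
    using S(2) by blast
qed

end

section \<open>The characteristic function\<close>

text \<open>The equation \<open>y - z S y = x\<close> is a fixed point problem for the strict contraction \<open>y \<mapsto> x + z S y\<close>.\<close>

lemma resolvent_bij:
  fixes S :: "'a::complex_hilbert \<Rightarrow> 'a"
  assumes S: "contraction S" and z: "cmod z < 1"
  shows "bij (\<lambda>y. y - z *\<^sub>C S y)"
proof -
  have lin: "bounded_clinear S"
    using S by (simp add: contraction_def)
  have "\<exists>!y. x + z *\<^sub>C S y = y" for x
  proof (rule banach_fix_type[of "cmod z"])
    have "norm (z *\<^sub>C S (y - y')) \<le> cmod z * norm (y - y')" for y y'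
      using S by (simp add: norm_scaleC contraction_def mult_left_mono)
    then show "\<forall>y y'. dist (x + z *\<^sub>C S y) (x + z *\<^sub>C S y') \<le> cmod z * dist y y'"
      by (simp add: dist_norm bounded_clinear_simps[OF lin])
  qed (use z in auto)
  then have "\<exists>!y. x = y - z *\<^sub>C S y" for x
    by (simp add: eq_diff_eq)
  then show ?thesis
    by (simp add: bij_iff eq_commute)
qed

context bilateral_model
begin

lemma coord_ker_T:
  assumes "T h = 0" and "n \<noteq> int m - 1" "n \<noteq> - 1"
  shows "coord h n = 0"
proof -
  have "coord (T h) (n + 1) = 0"
    using assms(1) by simp
  then show ?thesis
    using assms(2,3) by (simp add: coord_T split: if_splits)
qed

lemma T_eq_0_iff: "T h = 0 \<longleftrightarrow> (\<forall>n. n \<noteq> int m - 1 \<and> n \<noteq> - 1 \<longrightarrow> coord h n = 0) \<and>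
    D (snd (coord h (int m - 1))) = A (fst (coord h (- 1)))"
proof (intro iffI conjI)
  assume h: "T h = 0"
  then show "\<forall>n. n \<noteq> int m - 1 \<and> n \<noteq> - 1 \<longrightarrow> coord h n = 0"
    using coord_ker_T by blast
  have "coord (T h) (int m) = 0"
    using h by simp
  then show "D (snd (coord h (int m - 1))) = A (fst (coord h (- 1)))"
    using m by (simp add: coord_T prod_eq_iff)
next
  assume "(\<forall>n. n \<noteq> int m - 1 \<and> n \<noteq> - 1 \<longrightarrow> coord h n = 0) \<and>
    D (snd (coord h (int m - 1))) = A (fst (coord h (- 1)))"
  then show "T h = 0"
    by (intro bilateral_sum_eqI) (auto simp: coord_T)
qed

text \<open>The unitary map \<open>\<M> \<rightarrow> ker T\<close> and its inverse.\<close>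

definition ker_param :: "'m \<Rightarrow> ('m, 'n) bilateral_sum" where
  "ker_param u = incl_nonneg (m - 1) (A u) + incl_neg (- 1) (DA u)"

definition ker_coord :: "('m, 'n) bilateral_sum \<Rightarrow> 'm" where
  "ker_coord h = As (snd (coord h (int m - 1))) + DA (fst (coord h (- 1)))"

lemma coord_ker_param:
  "coord (ker_param u) n = (if n = int m - 1 then (0, A u) else if n = - 1 then (DA u, 0) else 0)"
  using m by (auto simp: ker_param_def)

lemma T_ker_param: "T (ker_param u) = 0"
  using m by (simp add: T_eq_0_iff coord_ker_param A_DA)

lemma ker_coord_ker_param: "ker_coord (ker_param u) = u"
  using m by (simp add: ker_coord_def coord_ker_param DA_square)

lemma A_ker_coord:
  assumes "T h = 0"
  shows "A (ker_coord h) = snd (coord h (int m - 1))"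
proof -
  have "A (ker_coord h) = A (As (snd (coord h (int m - 1)))) + D (A (fst (coord h (- 1))))"
    by (simp add: ker_coord_def A_DA)
  also have "A (fst (coord h (- 1))) = D (snd (coord h (int m - 1)))"
    using assms by (simp add: T_eq_0_iff)
  finally show ?thesis
    by (simp add: D_square)
qed

lemma DA_ker_coord:
  assumes "T h = 0"
  shows "DA (ker_coord h) = fst (coord h (- 1))"
proof -
  have "DA (ker_coord h) = As (D (snd (coord h (int m - 1)))) + DA (DA (fst (coord h (- 1))))"
    by (simp add: ker_coord_def DA_As)
  also have "D (snd (coord h (int m - 1))) = A (fst (coord h (- 1)))"
    using assms by (simp add: T_eq_0_iff)
  finally show ?thesis
    by (simp add: DA_square)
qed

lemma ker_param_ker_coord:
  assumes "T h = 0"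
  shows "ker_param (ker_coord h) = h"
proof (rule bilateral_sum_eqI)
  fix n
  show "coord (ker_param (ker_coord h)) n = coord h n"
    using m assms coord_ker_T[OF assms, of n]
    by (simp add: coord_ker_param A_ker_coord DA_ker_coord prod_eq_iff)
qed

lemma norm_ker_param: "norm (ker_param u) = norm u"
proof -
  have "(norm (ker_param u))\<^sup>2 = (\<Sum>n\<in>{int m - 1, - 1}. (norm (coord (ker_param u) n))\<^sup>2)"
    by (rule norm_supported) (auto simp: coord_ker_param)
  also have "\<dots> = (norm (A u))\<^sup>2 + (norm (DA u))\<^sup>2"
    using m by (simp add: coord_ker_param norm_Pair)
  also have "\<dots> = (norm u)\<^sup>2"
    by (simp add: norm_defect_op[OF A_contraction])
  finally show ?thesis
    by simp
qed

text \<open>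
  Below \<open>m - 1\<close> the equation reads \<open>y\<^sub>n = z y\<^bsub>n+1\<^esub>\<close>, so \<open>y\<^sub>0\<close> is \<open>z\<^bsup>m-1\<^esup> y\<^bsub>m-1\<^esub>\<close>; and \<open>y\<^bsub>m-1\<^esub>\<close> is the
  coordinate of \<open>h\<close>, because nothing arrives from \<open>\<L>\<^sub>m\<close>.
\<close>

lemma resolvent_coord_0:
  assumes h: "T h = 0" and z: "cmod z < 1" and y: "y - z *\<^sub>C Ts y = h"
  shows "coord y 0 = z ^ (m - 1) *\<^sub>C coord h (int m - 1)"
proof -
  have y_eq: "coord y n = coord h n + z *\<^sub>C coord (Ts y) n" for n
    unfolding y[symmetric] by simp
  have step: "coord y n = z *\<^sub>C coord y (n + 1)" if "0 \<le> n" "n \<noteq> int m - 1" for n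
    using y_eq[of n] coord_ker_T[OF h, of n] that by (simp add: coord_Ts)
  \<comment> \<open>From index \<open>m\<close> on, \<open>y\<^sub>n = z y\<^bsub>n+1\<^esub>\<close> would make \<open>y\<close> grow geometrically if it did not vanish.\<close>
  have "coord y (int m) = z ^ j *\<^sub>C coord y (int m + int j)" for j
  proof (induction j)
    case (Suc j)
    have "coord y (int m) = z ^ j *\<^sub>C (z *\<^sub>C coord y (int m + int j + 1))"
      unfolding Suc[symmetric] using step[of "int m + int j"] Suc by simp
    then show ?case
      by (simp only: scaleC_scaleC power_Suc2 of_nat_Suc ac_simps)
  qed simp
  then have "norm (coord y (int m)) \<le> cmod z ^ j * norm y" for j
    by (metis norm_coord_le norm_ge_zero norm_power norm_scaleC mult_left_mono)
  moreover have "(\<lambda>j. cmod z ^ j * norm y) \<longlonglongrightarrow> 0"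
    using z by (intro tendsto_mult_left_zero LIMSEQ_power_zero) simp
  ultimately have "norm (coord y (int m)) \<le> 0"
    by (intro LIMSEQ_le_const) auto
  then have "coord y (int m) = 0" by simp
  then have top: "coord y (int m - 1) = coord h (int m - 1)"
    using y_eq[of "int m - 1"] m by (simp add: coord_Ts)
  have "coord y (int m - 1 - int i) = z ^ i *\<^sub>C coord h (int m - 1)" if "i \<le> m - 1" for i
    using that
  proof (induction i)
    case (Suc i)
    have "coord y (int m - 1 - int (Suc i)) = z *\<^sub>C coord y (int m - 1 - int (Suc i) + 1)"
      using Suc.prems by (intro step) auto
    also have "int m - 1 - int (Suc i) + 1 = int m - 1 - int i"
      by simp
    also have "coord y (int m - 1 - int i) = z ^ i *\<^sub>C coord h (int m - 1)"
      using Suc by simp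
    finally show ?case
      by simp
  qed (simp add: top)
  from this[of "m - 1"] show ?thesis
    using m by (simp add: of_nat_diff)
qed

lemma char_fun_T:
  assumes h: "T h = 0" and z: "z \<in> ball 0 1"
  shows "char_fun T z h = z ^ m *\<^sub>C incl_nonneg 0 (snd (coord h (int m - 1)))"
proof -
  have z1: "cmod z < 1" using z by simp
  define y where "y = inv (\<lambda>y. y - z *\<^sub>C Ts y) h"
  have "y - z *\<^sub>C Ts y = h"
    unfolding y_def
    using surj_f_inv_f[OF bij_is_surj[OF resolvent_bij[OF Ts_contraction z1]]] .
  from resolvent_coord_0[OF h z1 this]
  have "coord y 0 = z ^ (m - 1) *\<^sub>C coord h (int m - 1)" .
  moreover have "char_fun T z h = z *\<^sub>C coord_proj {0} y"
    using h by (simp add: char_fun_def cadjoint_T defect_op_T defect_op_Ts y_def)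
  moreover have "z ^ m = z * z ^ (m - 1)"
    using m by (simp add: power_eq_if)
  moreover have "coord h (int m - 1) = (0, snd (coord h (int m - 1)))"
    using m by (intro coord_nonneg) simp
  ultimately show ?thesis
    by (intro bilateral_sum_eqI) (auto simp: prod_eq_iff)
qed

lemma bounded_clinear_on_incl_0:
  "bounded_clinear_on {h. T h = 0} (summands {0} :: ('m, 'n) bilateral_sum set)
     (\<lambda>h. a *\<^sub>C incl_nonneg 0 (snd (coord h (int m - 1))))"
  unfolding bounded_clinear_on_def
proof (intro conjI ballI allI exI[of _ "cmod a"])
  show "(\<lambda>h. a *\<^sub>C incl_nonneg 0 (snd (coord h (int m - 1)))) ` {h. T h = 0} \<subseteq> (summands {0} :: ('m, 'n) bilateral_sum set)"
    by (auto simp: mem_summands)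
  fix x y :: "('m, 'n) bilateral_sum" and b
  show "(a *\<^sub>C incl_nonneg 0 (snd (coord (x + y) (int m - 1))) :: ('m, 'n) bilateral_sum)
      = a *\<^sub>C incl_nonneg 0 (snd (coord x (int m - 1))) + a *\<^sub>C incl_nonneg 0 (snd (coord y (int m - 1)))"
    by (rule bilateral_sum_eqI) (simp add: scaleC_add_right)
  show "(a *\<^sub>C incl_nonneg 0 (snd (coord (b *\<^sub>C x) (int m - 1))) :: ('m, 'n) bilateral_sum)
      = b *\<^sub>C a *\<^sub>C incl_nonneg 0 (snd (coord x (int m - 1)))"
    by (rule bilateral_sum_eqI) (simp add: mult.commute)
  have "(norm (incl_nonneg 0 v :: ('m, 'n) bilateral_sum))\<^sup>2 = (norm v)\<^sup>2" for v
    by (subst norm_supported[of "{0}"]) (simp_all add: norm_Pair)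
  then have "norm (incl_nonneg 0 v :: ('m, 'n) bilateral_sum) = norm v" for v
    by simp
  moreover have "norm (snd (coord x (int m - 1))) \<le> norm x"
    using norm_snd_le[of "snd (coord x (int m - 1))" "fst (coord x (int m - 1))"]
      norm_coord_le[of x "int m - 1"] by simp
  ultimately show "norm (a *\<^sub>C incl_nonneg 0 (snd (coord x (int m - 1))) :: ('m, 'n) bilateral_sum) \<le> cmod a * norm x"
    by (simp add: norm_scaleC mult_left_mono)
qed

lemma char_fun_coincides:
  "coincide {h. T h = 0} (summands {0}) (char_fun T) UNIV UNIV (\<lambda>z h. z ^ m *\<^sub>C A h)"
  unfolding coincide_def
proof (intro conjI exI)
  have "bounded_clinear_on {h. T h = 0} (summands {0}) (char_fun T z)" if "z \<in> ball 0 1" for z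
    using bounded_clinear_on_incl_0[of "z ^ m"] that char_fun_T[OF _ that]
    by (simp add: bounded_clinear_on_def image_subset_iff)
  then show "op_valued_function {h. T h = 0} (summands {0}) (char_fun T)"
    by (simp add: op_valued_function_def)
  have "bounded_clinear_on UNIV UNIV (\<lambda>h. z ^ m *\<^sub>C A h)" for z
    using A_contraction
    by (auto simp: bounded_clinear_on_def scaleC_add_right mult.commute norm_scaleC contraction_def
        intro!: exI[of _ "cmod (z ^ m)"] mult_right_mono)
  then show "op_valued_function UNIV UNIV (\<lambda>z h. z ^ m *\<^sub>C A h)"
    by (simp add: op_valued_function_def)
  have norm: "norm (ker_coord h) = norm h" if "T h = 0" for h
    using norm_ker_param[of "ker_coord h"] ker_param_ker_coord[OF that] by simp
  have "ker_coord ` {h. T h = 0} = UNIV"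
    using T_ker_param ker_coord_ker_param by (metis (mono_tags, lifting) UNIV_eq_I image_eqI mem_Collect_eq)
  then show "unitary_on {h. T h = 0} UNIV ker_coord"
    using norm unfolding unitary_on_def bounded_clinear_on_def
    by (auto simp: ker_coord_def scaleC_add_right intro!: exI[of _ 1])
  have norm0: "norm (snd (coord g 0)) = norm g" if "g \<in> summands {0}" for g :: "('m, 'n) bilateral_sum"
  proof -
    have "(norm g)\<^sup>2 = (norm (coord g 0))\<^sup>2"
      by (subst norm_supported[of "{0}"]) (use that in \<open>auto simp: mem_summands\<close>)
    then show ?thesis
      by (subst (asm) coord_nonneg) (simp_all add: norm_Pair)
  qed
  have "(\<lambda>g. snd (coord g 0)) ` (summands {0} :: ('m, 'n) bilateral_sum set) = UNIV"
  proof (rule UNIV_eq_I[symmetric], rule image_eqI)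
    fix v :: 'n
    show "v = snd (coord (incl_nonneg 0 v :: ('m, 'n) bilateral_sum) 0)"
      by simp
    show "incl_nonneg 0 v \<in> (summands {0} :: ('m, 'n) bilateral_sum set)"
      by (simp add: mem_summands)
  qed
  then show "unitary_on (summands {0}) UNIV (\<lambda>g :: ('m, 'n) bilateral_sum. snd (coord g 0))"
    using norm0 unfolding unitary_on_def bounded_clinear_on_def
    by (auto intro!: exI[of _ 1])
  show "\<forall>z\<in>ball 0 1. \<forall>x\<in>{h. T h = 0}. snd (coord (char_fun T z x) 0) = z ^ m *\<^sub>C A (ker_coord x)"
    using char_fun_T A_ker_coord by simp
qed

lemma char_fun_polynomial:
  assumes "A v \<noteq> 0"
  shows "op_polynomial {h. T h = 0} (summands {0}) (char_fun T) m"
  unfolding op_polynomial_def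
proof (intro exI conjI)
  let ?C = "\<lambda>k (h :: ('m, 'n) bilateral_sum).
    (if k = m then 1 else 0) *\<^sub>C (incl_nonneg 0 (snd (coord h (int m - 1))) :: ('m, 'n) bilateral_sum)"
  show "\<forall>k\<le>m. bounded_clinear_on {h. T h = 0} (summands {0}) (?C k)"
    by (intro allI impI bounded_clinear_on_incl_0)
  have "coord (?C m (ker_param v)) 0 \<noteq> 0"
    using assms by (simp add: coord_ker_param prod_eq_iff)
  then have "?C m (ker_param v) \<noteq> 0"
    by (metis coord_simps(1))
  then show "\<exists>x\<in>{h. T h = 0}. ?C m x \<noteq> 0"
    using T_ker_param by blast
  show "\<forall>z\<in>ball 0 1. \<forall>x\<in>{h. T h = 0}. char_fun T z x = (\<Sum>k\<le>m. z ^ k *\<^sub>C ?C k x)"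
  proof (intro ballI)
    fix z :: complex and x assume z: "z \<in> ball 0 1" and x: "x \<in> {h. T h = 0}"
    have "char_fun T z x = z ^ m *\<^sub>C incl_nonneg 0 (snd (coord x (int m - 1)))"
      using x by (intro char_fun_T[OF _ z]) simp
    also have "\<dots> = (\<Sum>k\<le>m. if k = m then z ^ k *\<^sub>C incl_nonneg 0 (snd (coord x (int m - 1))) else 0)"
      by simp
    also have "\<dots> = (\<Sum>k\<le>m. z ^ k *\<^sub>C ?C k x)"
      by (rule sum.cong) auto
    finally show "char_fun T z x = (\<Sum>k\<le>m. z ^ k *\<^sub>C ?C k x)" .
  qed
qed

section \<open>The canonical representation\<close>

lemma T_summands_atLeast:
  assumes "h \<in> summands {int j..}"
  shows "T h \<in> summands {int (Suc j)..}"
proof -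
  have "coord h (int m - 1) = 0" if "m \<le> j"
    using assms that by (simp add: mem_summands)
  moreover have "coord h (- 1) = 0"
    using assms by (simp add: mem_summands)
  ultimately show ?thesis
    using assms by (auto simp: mem_summands coord_T)
qed

lemma T_pow_summands_0: "h \<in> summands {0} \<Longrightarrow> (T ^^ k) h \<in> summands {int k..}"
proof (induction k)
  case (Suc k)
  then show ?case
    using T_summands_atLeast[of "(T ^^ k) h" k] by simp
qed (auto simp: mem_summands)

lemma T_pow_incl_0:
  "(T ^^ k) (incl_nonneg 0 x) = incl_nonneg k (if k < m then x else D x)"
proof (induction k)
  case 0
  then show ?case using m by simp
next
  case (Suc k)
  have "D 0 = 0" "A 0 = 0" by simp_all
  note T_incl = T_A_incl_nonneg[OF m this(2,1)] T_A_incl_pred[OF m this(2,1)]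
  show ?case
  proof (cases "k = m - 1")
    case True
    then have "Suc k = m" using m by simp
    have "(T ^^ Suc k) (incl_nonneg 0 x) = T ((T ^^ k) (incl_nonneg 0 x))"
      by simp
    also have "\<dots> = T (incl_nonneg (m - 1) x)"
      unfolding Suc using True m by simp
    also have "\<dots> = incl_nonneg m (D x)"
      by (rule T_incl(2))
    finally show ?thesis
      using \<open>Suc k = m\<close> by simp
  next
    case False
    then show ?thesis
      using Suc m T_incl(1)[of k] by auto
  qed
qed

text \<open>
  The vectors \<open>T\<^sup>k h\<close> with \<open>k \<ge> m\<close>, \<open>h \<in> \<L>\<^sub>0\<close>, fill \<open>Ran D\<close> in \<open>\<L>\<^sub>k\<close>.  A vector of the summands
  from \<open>m\<close> on that is orthogonal to all of them is annihilated by \<open>D\<close> in each coordinate, so it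
  vanishes.
\<close>

lemma canonical_space_1_T: "canonical_space_1 T m = summands {int m..}"
proof -
  define X where "X = {(T ^^ k) h |k h. m \<le> k \<and> h \<in> summands {0}}"
  have W: "canonical_space_1 T m = closure (cspan X)"
    by (simp add: canonical_space_1_def cadjoint_T defect_space_Ts X_def)
  have "X \<subseteq> summands {int m..}"
    using T_pow_summands_0 by (fastforce simp: X_def mem_summands)
  then have "cspan X \<subseteq> summands {int m..}"
    using closed_summands[of "{int m..}"]
    by (intro complex_vector.span_minimal) (auto simp: closed_csubspace_def)
  then have sub: "closure (cspan X) \<subseteq> summands {int m..}"
    using closed_summands[of "{int m..}"] by (intro closure_minimal) (auto simp: closed_csubspace_def)
  have "subspace (cspan X)"
    by (auto simp: subspace_def complex_vector.span_zero complex_vector.span_add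
        scaleR_scaleC complex_vector.span_scale)
  then have "subspace (closure (cspan X))"
    by (rule subspace_closure)
  have "h \<in> closure (cspan X)" if h: "h \<in> summands {int m..}" for h
  proof -
    obtain w where w: "w \<in> closure (cspan X)" and orth: "\<And>v. v \<in> closure (cspan X) \<Longrightarrow> inner (h - w) v = 0"
      using orthogonal_projection_exists[OF \<open>subspace (closure (cspan X))\<close> closed_closure] by blast
    define g where "g = h - w"
    have g: "g \<in> summands {int m..}"
      using h w sub by (auto simp: g_def mem_summands)
    have "snd (coord g (int j)) = 0" if "m \<le> j" for j
    proof -
      \<comment> \<open>The vector \<open>g\<close> is orthogonal to the copy of \<open>Ran D\<close> in \<open>\<L>\<^sub>j\<close>, so \<open>D\<close> annihilates its coordinate.\<close>
      let ?v = "(T ^^ j) (incl_nonneg 0 (D (snd (coord g (int j)))))"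
      have "?v \<in> cspan X"
        unfolding X_def using that
        by (intro complex_vector.span_base CollectI exI[of _ j] exI[of _ "incl_nonneg 0 (D (snd (coord g (int j))))"])
          (simp add: mem_summands)
      then have "inner g ?v = 0"
        using orth closure_subset by (auto simp: g_def)
      then have "Re (cinner (snd (coord g (int j))) (D (D (snd (coord g (int j)))))) = 0"
        using that by (simp add: Re_cinner[symmetric] T_pow_incl_0 cinner_incl_nonneg)
      then have "D (snd (coord g (int j))) = 0"
        unfolding defect_op_sym[OF As_contraction, symmetric, of _ "D _"] by (simp add: Re_cinner)
      then show ?thesis
        by (rule D_injective)
    qed
    then have "coord g n = 0" for n
    proof (cases "int m \<le> n")
      case True
      then obtain j where "n = int j" "m \<le> j"
        by (metis nat_int_comparison(3) nat_0_le of_nat_0_le_iff order_trans)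
      then show ?thesis
        using \<open>\<And>j. m \<le> j \<Longrightarrow> snd (coord g (int j)) = 0\<close> by (simp add: prod_eq_iff)
    qed (use g in \<open>simp add: mem_summands\<close>)
    then have "g = 0"
      by (intro bilateral_sum_eqI) simp
    then show ?thesis
      using w by (simp add: g_def)
  qed
  then show ?thesis
    using sub W by blast
qed

lemma Ts_summands_neg:
  assumes "h \<in> summands {..- 1}"
  shows "Ts h \<in> summands {..- 1}"
  using assms by (auto simp: mem_summands coord_Ts)

lemma canonical_space_minus1_T: "canonical_space_minus1 T = summands {..- 1}"
proof -
  have iff: "norm (Ts h) = norm h \<longleftrightarrow> coord h 0 = 0" for h
    using norm_Ts[of h] power2_eq_iff_nonneg[of "norm (Ts h)" "norm h"] by auto
  have "(Ts ^^ k) h \<in> summands {..- 1}" if "h \<in> summands {..- 1}" for h k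
    using that by (induction k) (auto intro: Ts_summands_neg)
  then have "coord ((Ts ^^ k) h) 0 = 0" if "h \<in> summands {..- 1}" for h k
    using that by (auto simp: mem_summands)
  then show ?thesis
    using summands_neg_if by (auto simp: canonical_space_minus1_def cadjoint_T iff)
qed

lemma canonical_space_0_T: "canonical_space_0 T m = summands {0..<int m}"
  unfolding canonical_space_0_def canonical_space_1_T canonical_space_minus1_T
proof (intro equalityI subsetI)
  fix h :: "('m, 'n) bilateral_sum"
  assume h: "h \<in> orth_complement {a + b |a b. a \<in> summands {int m..} \<and> b \<in> summands {..- 1}}"
  show "h \<in> summands {0..<int m}"
    unfolding mem_summands
  proof (intro allI impI)
    fix n assume n: "n \<notin> {0..<int m}"
    have "coord_proj {n} h \<in> {a + b |a b. a \<in> summands {int m..} \<and> b \<in> summands {..- 1}}"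
    proof (cases "int m \<le> n")
      case True
      then show ?thesis
        by (intro CollectI exI[of _ "coord_proj {n} h"] exI[of _ 0]) (simp add: mem_summands)
    next
      case False
      then show ?thesis
        using n by (intro CollectI exI[of _ 0] exI[of _ "coord_proj {n} h"]) (auto simp: mem_summands)
    qed
    with h have "cinner h (coord_proj {n} h) = 0"
      unfolding orth_complement_def by blast
    then show "coord h n = 0"
      by (simp add: cinner_coord_proj_single cinner_self)
  qed
next
  fix h :: "('m, 'n) bilateral_sum"
  assume h: "h \<in> summands {0..<int m}"
  have "h \<in> orth_complement (summands {int m..})" "h \<in> orth_complement (summands {..- 1})"
    by (rule subsetD[OF summands_orthogonal h]; auto)+
  then show "h \<in> orth_complement {a + b |a b. a \<in> summands {int m..} \<and> b \<in> summands {..- 1}}"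
    by (auto simp: orth_complement_def cinner_add_right)
qed

lemma upper_triangular_T:
  "upper_triangular_rep T (summands {int m..}) (summands {0..<int m}) (summands {..- 1})"
  unfolding upper_triangular_rep_def
proof (intro conjI closed_summands summands_orthogonal allI)
  fix h :: "('m, 'n) bilateral_sum"
  have "h = coord_proj {int m..} h + coord_proj {0..<int m} h + coord_proj {..- 1} h"
    by (rule bilateral_sum_eqI) auto
  then show "\<exists>a\<in>summands {int m..}. \<exists>b\<in>summands {0..<int m}. \<exists>c\<in>summands {..- 1}. h = a + b + c"
    using coord_proj_in_summands by blast
next
  show "T ` summands {int m..} \<subseteq> summands {int m..}"
    using T_summands_atLeast by (fastforce simp: mem_summands)
  show "T ` summands {0..<int m} \<subseteq> {a + b |a b. a \<in> summands {int m..} \<and> b \<in> summands {0..<int m}}"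
  proof clarify
    fix h :: "('m, 'n) bilateral_sum"
    assume h: "h \<in> summands {0..<int m}"
    have "T h = coord_proj {int m..} (T h) + coord_proj {0..<int m} (T h)"
      using h m by (intro bilateral_sum_eqI) (auto simp: coord_T mem_summands)
    then show "\<exists>a b. T h = a + b \<and> a \<in> summands {int m..} \<and> b \<in> summands {0..<int m}"
      using coord_proj_in_summands by blast
  qed
qed auto

end

theorem theorem7p3:
  fixes A :: "'m::complex_hilbert \<Rightarrow> 'n::complex_hilbert" and m :: nat
  assumes "m \<ge> 1"
    and "separable_space (euclidean :: 'm topology)"
    and "separable_space (euclidean :: 'n topology)"
    and "pure_contraction A"
    and "\<exists>h. A h \<noteq> 0"
  shows "completely_non_unitary (T_A m A) \<and> partial_isometry (T_A m A) \<and>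
    coincide
      (defect_space (T_A m A)) (defect_space (cadjoint (T_A m A))) (char_fun (T_A m A))
      UNIV UNIV (\<lambda>z h. z ^ m *\<^sub>C A h) \<and>
    canonical_representation (T_A m A) m (summands {int m..}) (summands {0..<int m}) (summands {..-1})"
proof -
  interpret bilateral_model A m
    using assms(1,4) by unfold_locales
  obtain v where "A v \<noteq> 0"
    using assms(5) by blast
  then show ?thesis
    unfolding canonical_representation_def cadjoint_T defect_space_T defect_space_Ts
      canonical_space_1_T canonical_space_0_T canonical_space_minus1_T
    using completely_non_unitary_T partial_isometry_T char_fun_coincides char_fun_polynomial upper_triangular_T
    by blast
qed

end
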